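(* Let $(b_k)_{k\ge0}$ be either $b_k=q^k$ for some $0<q<1$, or $b_k=\frac{1}{(k+1)^{\alpha}}$ for some $\alpha>0$. For $k\in\mathbb{N}$ let $g_k:[0,1]\to[b_k,b_{k-1}]$ be the affine decreasing bijection, let $J_n$ be the limit set of $S_n=\{g_1,\dots,g_n\}$ and $h_n$ its Hausdorff dimension. Then $$\lim_{n\to\infty}(1-h_n)\ln n=0\qquad\text{and}\qquad \sup_{k\in\mathbb{N}}\left\{\frac{b_k-b_{k+1}}{b_{k+1}}\right\}<\infty ,$$ and consequently $\lim_{n\to\infty}H_{h_n}(J_n)=1$.
   Context: $\mathbb{N}=\{1,2,\dots\}$. The map $g_k$ satisfies $g_k(0)=b_{k-1}$, $g_k(1)=b_k$. The limit set is $J_n=\bigcap_{l=1}^{\infty}\bigcup_{(q_1,\dots,q_l)\in\{1,\dots,n\}^l} g_{q_1}\circ\cdots\circ g_{q_l}([0,1])$. $H_h$ denotes $h$-dimensional Hausdorff measure, $H_h(A)=\lim_{\delta\to0}\inf\{\sum_i \operatorname{diam}(U_i)^h: A\subset\bigcup_i U_i,\ \operatorname{diam}(U_i)\le\delta\}$ (so $H_1$ is Lebesgue measure on $\mathbb{R}$). *)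

theory Defs
  imports "HOL-Analysis.Analysis"
begin

(* diam(U)^s with the conventions 0^0 = 1 and diam({})^s = 0; powr alone would give 0 powr 0 = 0. *)
definition diam_pow :: "real \<Rightarrow> 'a::metric_space set \<Rightarrow> ennreal" where
  "diam_pow s U = (if U = {} then 0 else if s = 0 then 1 else ennreal (diameter U powr s))"

(* Boundedness is required explicitly because diameter is an unspecified real number on
   unbounded sets. Finite covers are included, since U i may be empty. *)
definition delta_cover :: "real \<Rightarrow> 'a::metric_space set \<Rightarrow> (nat \<Rightarrow> 'a set) set" where
  "delta_cover \<delta> A = {U. A \<subseteq> (\<Union>i. U i) \<and> (\<forall>i. bounded (U i) \<and> diameter (U i) \<le> \<delta>)}"

definition hausdorff_pre :: "real \<Rightarrow> real \<Rightarrow> 'a::metric_space set \<Rightarrow> ennreal" where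
  "hausdorff_pre s \<delta> A = (INF U \<in> delta_cover \<delta> A. \<Sum>i. diam_pow s (U i))"

definition hausdorff_measure :: "real \<Rightarrow> 'a::metric_space set \<Rightarrow> ennreal" where
  "hausdorff_measure s A = Lim (at_right 0) (\<lambda>\<delta>. hausdorff_pre s \<delta> A)"

(* The limit always exists, being a monotone one. *)
lemma hausdorff_pre_tendsto:
  "((\<lambda>\<delta>. hausdorff_pre s \<delta> A) \<longlongrightarrow> (SUP \<delta>\<in>{0<..}. hausdorff_pre s \<delta> A)) (at_right 0)"
proof (rule order_tendstoI)
  fix a assume "a < (SUP \<delta>\<in>{0<..}. hausdorff_pre s \<delta> A)"
  then obtain d where d: "d > 0" "a < hausdorff_pre s d A"
    by (auto simp: less_SUP_iff)
  have "a < hausdorff_pre s \<delta> A" if "\<delta> < d" for \<delta>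
  proof -
    have "delta_cover \<delta> A \<subseteq> delta_cover d A"
      using that by (auto simp: delta_cover_def intro: order_trans[OF _ less_imp_le])
    then have "hausdorff_pre s d A \<le> hausdorff_pre s \<delta> A"
      unfolding hausdorff_pre_def by (rule INF_superset_mono) simp
    with d(2) show ?thesis by simp
  qed
  then show "\<forall>\<^sub>F \<delta> in at_right 0. a < hausdorff_pre s \<delta> A"
    using d(1) unfolding eventually_at_right_field by blast
next
  fix a assume "(SUP \<delta>\<in>{0<..}. hausdorff_pre s \<delta> A) < a"
  then have "hausdorff_pre s \<delta> A < a" if "\<delta> > 0" for \<delta>
    using that by (metis SUP_upper greaterThan_iff order_le_less_trans)
  then show "\<forall>\<^sub>F \<delta> in at_right 0. hausdorff_pre s \<delta> A < a"
    by (auto simp: eventually_at_right_field intro: exI[of _ 1])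
qed

lemma hausdorff_measure_eq_SUP:
  "hausdorff_measure s A = (SUP \<delta>\<in>{0<..}. hausdorff_pre s \<delta> A)"
  unfolding hausdorff_measure_def
  by (rule tendsto_Lim[OF _ hausdorff_pre_tendsto]) simp

(* In a euclidean space the s-dimensional measure of every set vanishes for s > DIM('a), so this
   is an infimum over a nonempty set bounded below. *)
definition hausdorff_dim :: "'a::euclidean_space set \<Rightarrow> real" where
  "hausdorff_dim A = Inf {s. 0 \<le> s \<and> hausdorff_measure s A = 0}"

definition compose_word :: "(nat \<Rightarrow> real \<Rightarrow> real) \<Rightarrow> nat list \<Rightarrow> real \<Rightarrow> real" where
  "compose_word f qs = foldr (\<lambda>q \<phi>. f q \<circ> \<phi>) qs id"

definition limit_set :: "(nat \<Rightarrow> real \<Rightarrow> real) \<Rightarrow> nat \<Rightarrow> real set" where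
  "limit_set f n =
    (\<Inter>l\<in>{1..}. \<Union>qs\<in>{qs. length qs = l \<and> set qs \<subseteq> {1..n}}. compose_word f qs ` {0..1})"

(* Used for k >= 1 and on [0,1] only. *)
definition g :: "(nat \<Rightarrow> real) \<Rightarrow> nat \<Rightarrow> real \<Rightarrow> real" where
  "g b k x = b (k - 1) - (b (k - 1) - b k) * x"

lemma g_endpoints: "g b k 0 = b (k - 1)" "g b k 1 = b k"
  by (simp_all add: g_def)

lemma g_bij_betw:
  assumes "b k < b (k - 1)"
  shows "bij_betw (g b k) {0..1} {b k..b (k - 1)}"
proof (rule bij_betw_byWitness[where f' = "\<lambda>y. (b (k - 1) - y) / (b (k - 1) - b k)"])
  have "b k \<le> g b k x \<and> g b k x \<le> b (k - 1)" if "0 \<le> x" "x \<le> 1" for x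
    using that assms mult_left_le[of x "b (k - 1) - b k"]
      mult_nonneg_nonneg[of "b (k - 1) - b k" x]
    unfolding g_def by linarith
  then show "g b k ` {0..1} \<subseteq> {b k..b (k - 1)}" by auto
qed (use assms in \<open>auto simp: g_def field_simps\<close>)

definition J :: "(nat \<Rightarrow> real) \<Rightarrow> nat \<Rightarrow> real set" where
  "J b n = limit_set (g b) n"

end

theory Submission
  imports Defs "HOL-Real_Asymp.Real_Asymp"
begin

text \<open>
  Write \<open>a k = b (k - 1) - b k\<close> and let \<open>h\<close> be the solution of \<open>\<Sum>k=1..n. a k powr h = 1\<close>.
  Covering \<open>J b n\<close> by cylinders gives \<open>H\<^sub>h(J) \<le> 1\<close>. For the lower bound let \<open>F\<close> be the
  distribution function of the self-similar measure, the fixed point of the operator \<open>T\<close>.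
  Since \<open>F\<close> maps \<open>J\<close> onto \<open>[0,1]\<close>, a bound \<open>F y - F x \<le> C (y - x) powr h\<close> yields
  \<open>H\<^sub>h(J) \<ge> 1 / C\<close>. By self-similarity only intervals straddling a point \<open>b m\<close> matter.
  First-level pieces have mass at most \<open>\<kappa>\<close> times their length with \<open>\<kappa> = a n powr (h - 1)\<close>, and the
  parts of the interval in its two extreme pieces are images of intervals at 0 or 1. For those,
  linear bounds \<open>F t \<le> A t\<close> and \<open>1 - F (1 - s) \<le> \<kappa> A s\<close> reproduce themselves under \<open>T\<close> for an \<open>A\<close>
  depending on \<open>\<kappa>\<close> and \<open>K = sup b k / b (k + 1)\<close>, with \<open>A \<rightarrow> 1\<close> as \<open>\<kappa> \<rightarrow> 1\<close>; so \<open>C = \<kappa>\<^sup>2 A\<close> works.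
  Finally \<open>1 - h = O(b n)\<close>, so that \<open>(1 - h) ln n \<rightarrow> 0\<close> and \<open>\<kappa> \<rightarrow> 1\<close>.
\<close>

section \<open>Hausdorff measure and dimension\<close>

text \<open>The finite cover is padded with empty sets, which cost nothing because
  \<open>diam_pow s {} = 0\<close>.\<close>

lemma hausdorff_pre_le_sum:
  fixes V :: "'i \<Rightarrow> 'a::metric_space set"
  assumes "finite I" "A \<subseteq> (\<Union>i\<in>I. V i)" "0 \<le> \<delta>"
    and "\<And>i. i \<in> I \<Longrightarrow> bounded (V i) \<and> diameter (V i) \<le> \<delta>"
  shows "hausdorff_pre s \<delta> A \<le> (\<Sum>i\<in>I. diam_pow s (V i))"
proof -
  obtain e where e: "bij_betw e {0..<card I} I"
    using ex_bij_betw_nat_finite[OF assms(1)] by blast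
  define U where "U = (\<lambda>j. if j < card I then V (e j) else {})"
  have mem: "e j \<in> I" if "j < card I" for j
    using e that by (auto simp: bij_betw_def)
  have "(\<Union>i\<in>I. V i) \<subseteq> (\<Union>j. U j)"
  proof
    fix x assume "x \<in> (\<Union>i\<in>I. V i)"
    then obtain i where "i \<in> I" "x \<in> V i" by blast
    moreover obtain j where "j < card I" "i = e j"
      using bij_betw_imp_surj_on[OF e] \<open>i \<in> I\<close> by force
    ultimately show "x \<in> (\<Union>j. U j)" by (auto simp: U_def)
  qed
  then have "U \<in> delta_cover \<delta> A"
    using assms mem by (auto simp: delta_cover_def U_def)
  then have "hausdorff_pre s \<delta> A \<le> (\<Sum>j. diam_pow s (U j))"
    unfolding hausdorff_pre_def by (rule INF_lower)
  also have "\<dots> = (\<Sum>j\<in>{0..<card I}. diam_pow s (U j))"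
    by (rule suminf_finite) (auto simp: U_def diam_pow_def)
  also have "\<dots> = (\<Sum>j\<in>{0..<card I}. diam_pow s (V (e j)))"
    by (rule sum.cong) (auto simp: U_def)
  also have "\<dots> = (\<Sum>i\<in>I. diam_pow s (V i))"
    by (rule sum.reindex_bij_betw[OF e])
  finally show ?thesis .
qed

lemma diam_pow_le:
  assumes "bounded U" "diameter U \<le> \<delta>" "0 \<le> s" "s < t"
  shows "diam_pow t U \<le> ennreal (\<delta> powr (t - s)) * diam_pow s U"
proof (cases "U = {}")
  case False
  have d: "0 \<le> diameter U" using assms(1) by (rule diameter_ge_0)
  have 1: "diameter U powr (t - s) \<le> \<delta> powr (t - s)"
    using d assms by (intro powr_mono2) auto
  show ?thesis
  proof (cases "s = 0")
    case True
    then show ?thesis using False assms 1 by (simp add: diam_pow_def ennreal_leI)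
  next
    case s: False
    have "diameter U powr t = diameter U powr (t - s) * diameter U powr s"
      by (simp flip: powr_add)
    also have "\<dots> \<le> \<delta> powr (t - s) * diameter U powr s"
      using 1 by (intro mult_right_mono) auto
    finally show ?thesis using False s assms
      by (simp add: diam_pow_def ennreal_leI flip: ennreal_mult)
  qed
qed (simp add: diam_pow_def)

lemma hausdorff_pre_le:
  fixes A :: "'a::metric_space set"
  assumes "0 \<le> s" "s < t" "0 < \<delta>"
  shows "hausdorff_pre t \<delta> A \<le> ennreal (\<delta> powr (t - s)) * hausdorff_pre s \<delta> A"
proof -
  define c where "c = \<delta> powr (t - s)"
  have c: "0 < c" using assms by (simp add: c_def)
  \<comment> \<open>Dividing by \<open>c\<close> first lets the inequality be shown for each cover
    and then passed to the infimum.\<close>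
  then have inv: "ennreal (1 / c) * ennreal c = 1" by (simp flip: ennreal_mult)
  have "ennreal (1 / c) * hausdorff_pre t \<delta> A \<le> (\<Sum>i. diam_pow s (U i))"
    if U: "U \<in> delta_cover \<delta> A" for U
  proof -
    have "hausdorff_pre t \<delta> A \<le> (\<Sum>i. diam_pow t (U i))"
      unfolding hausdorff_pre_def using U by (rule INF_lower)
    also have "\<dots> \<le> (\<Sum>i. ennreal c * diam_pow s (U i))"
      unfolding c_def
      using U assms by (intro suminf_le diam_pow_le) (auto simp: delta_cover_def)
    finally have "ennreal (1 / c) * hausdorff_pre t \<delta> A
        \<le> ennreal (1 / c) * (ennreal c * (\<Sum>i. diam_pow s (U i)))"
      by (intro mult_left_mono) auto
    then show ?thesis by (simp only: mult.assoc[symmetric] inv mult_1_left)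
  qed
  then have "ennreal (1 / c) * hausdorff_pre t \<delta> A \<le> hausdorff_pre s \<delta> A"
    unfolding hausdorff_pre_def[of s] by (intro INF_greatest)
  then have "ennreal c * (ennreal (1 / c) * hausdorff_pre t \<delta> A)
      \<le> ennreal c * hausdorff_pre s \<delta> A"
    by (intro mult_left_mono) auto
  then show ?thesis
    using inv unfolding c_def[symmetric]
    by (simp only: mult.assoc[symmetric] mult.commute[of "ennreal c" "ennreal (1 / c)"] mult_1_left)
qed

text \<open>Finiteness bounds every \<open>s\<close>-premeasure by one real \<open>r\<close>, and
  the factor \<open>\<delta> powr (t - s)\<close> gained by raising the exponent tends to 0.\<close>

lemma hausdorff_measure_eq_0:
  fixes A :: "'a::metric_space set"
  assumes "0 \<le> s" "s < t" "hausdorff_measure s A < \<infinity>"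
  shows "hausdorff_measure t A = 0"
proof -
  obtain r where r: "0 \<le> r" "hausdorff_measure s A = ennreal r"
    using assms(3) by (cases "hausdorff_measure s A") auto
  have "hausdorff_pre t \<delta> A \<le> ennreal (\<delta> powr (t - s) * r)" if "\<delta> > 0" for \<delta>
  proof -
    have "hausdorff_pre s \<delta> A \<le> ennreal r"
      unfolding r(2)[symmetric] hausdorff_measure_eq_SUP using that by (intro SUP_upper) auto
    then have "ennreal (\<delta> powr (t - s)) * hausdorff_pre s \<delta> A \<le> ennreal (\<delta> powr (t - s) * r)"
      by (simp add: ennreal_mult r mult_left_mono)
    then show ?thesis
      using hausdorff_pre_le[OF assms(1,2) that, of A] by (rule order_trans[rotated])
  qed
  then have "\<forall>\<^sub>F \<delta> in at_right 0. hausdorff_pre t \<delta> A \<le> ennreal (\<delta> powr (t - s) * r)"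
    unfolding eventually_at_right_field by (intro exI[of _ 1]) auto
  moreover have "((\<lambda>\<delta>. \<delta> powr (t - s) * r) \<longlongrightarrow> 0 powr (t - s) * r) (at_right 0)"
    using assms by (intro tendsto_intros) (auto simp: eventually_at_right_field intro!: exI[of _ 1])
  then have "((\<lambda>\<delta>. ennreal (\<delta> powr (t - s) * r)) \<longlongrightarrow> ennreal 0) (at_right 0)"
    by (intro tendsto_ennrealI) simp
  ultimately have "(SUP \<delta>\<in>{0<..}. hausdorff_pre t \<delta> A) \<le> ennreal 0"
    using hausdorff_pre_tendsto[of t A] by (intro tendsto_le) auto
  then show ?thesis by (simp add: hausdorff_measure_eq_SUP)
qed

text \<open>By \<open>hausdorff_measure_eq_0\<close> all exponents above \<open>s\<close> give
  measure 0, and a zero at some \<open>t < s\<close> would force one at \<open>s\<close>.\<close>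

lemma hausdorff_dim_eqI:
  assumes "0 \<le> s" "0 < hausdorff_measure s A" "hausdorff_measure s A < \<infinity>"
  shows "hausdorff_dim A = s"
proof -
  have "{t. 0 \<le> t \<and> hausdorff_measure t A = 0} = {s<..}"
    using assms hausdorff_measure_eq_0[of s _ A] hausdorff_measure_eq_0[of _ s A]
    by (force simp: not_less order.order_iff_strict)
  then show ?thesis by (simp add: hausdorff_dim_def)
qed

lemma hausdorff_measure_leI:
  fixes A :: "'a::metric_space set"
  assumes "\<And>\<delta>. 0 < \<delta> \<Longrightarrow> hausdorff_pre s \<delta> A \<le> c"
  shows "hausdorff_measure s A \<le> c"
  unfolding hausdorff_measure_eq_SUP using assms by (intro SUP_least) auto

text \<open>The mass distribution principle, with the measure replaced by its distribution function.\<close>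

lemma hausdorff_measure_ge_Hoelder:
  fixes F :: "real \<Rightarrow> real"
  assumes F: "\<And>x y. x \<le> y \<Longrightarrow> F x \<le> F y \<and> F y - F x \<le> C * (y - x) powr s"
    and A: "{0..1} \<subseteq> F ` A" and "0 < s" "0 < C"
  shows "ennreal (1 / C) \<le> hausdorff_measure s A"
proof -
  \<comment> \<open>One mesh size suffices for a lower bound, since the measure is the supremum of
    the premeasures.\<close>
  have "ennreal (1 / C) \<le> (\<Sum>i. diam_pow s (U i))" if U: "U \<in> delta_cover 1 A" for U
  proof -
    have bd: "bounded (U i)" for i using U by (auto simp: delta_cover_def)
    define V where "V = (\<lambda>i. if U i = {} then {} else {F (Inf (U i)) .. F (Sup (U i))})"
    have "F ` U i \<subseteq> V i" for i
      using F bd[of i] bounded_imp_bdd_above[of "U i"] bounded_imp_bdd_below[of "U i"]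
      by (auto simp: V_def cInf_lower cSup_upper)
    then have "F ` (\<Union>i. U i) \<subseteq> (\<Union>i. V i)" by blast
    moreover have "F ` A \<subseteq> F ` (\<Union>i. U i)"
      using U by (intro image_mono) (simp add: delta_cover_def)
    ultimately have cov: "{0..1} \<subseteq> (\<Union>i. V i)"
      using A by (meson order_trans)
    have V: "emeasure lborel (V i) \<le> ennreal C * diam_pow s (U i)" for i
    proof (cases "U i = {}")
      case False
      \<comment> \<open>The extreme points may lie outside \<open>U i\<close>, but they lie in its
        closure, which has the same diameter.\<close>
      have "Inf (U i) \<in> closure (U i)" "Sup (U i) \<in> closure (U i)"
        using False bd[of i] bounded_imp_bdd_above bounded_imp_bdd_below
        by (auto intro!: closure_contains_Inf closure_contains_Sup)
      then have "dist (Sup (U i)) (Inf (U i)) \<le> diameter (closure (U i))"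
        using bd[of i] by (intro diameter_bounded_bound) auto
      then have d: "Sup (U i) - Inf (U i) \<le> diameter (U i)"
        using bd[of i] by (simp add: diameter_closure dist_real_def)
      have le: "Inf (U i) \<le> Sup (U i)"
        using False bd[of i] bounded_imp_bdd_above bounded_imp_bdd_below
        by (intro cInf_le_cSup) auto
      have "F (Sup (U i)) - F (Inf (U i)) \<le> C * (Sup (U i) - Inf (U i)) powr s"
        using F[OF le] by simp
      also have "\<dots> \<le> C * diameter (U i) powr s"
        using d le assms by (intro mult_left_mono powr_mono2) auto
      finally have "ennreal (F (Sup (U i)) - F (Inf (U i))) \<le> ennreal (C * diameter (U i) powr s)"
        by (rule ennreal_leI)
      then show ?thesis
        using False assms F[OF le] by (simp add: V_def diam_pow_def ennreal_mult)
    qed (simp add: V_def)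
    have "1 = emeasure lborel {0..1::real}" by simp
    also have "\<dots> \<le> emeasure lborel (\<Union>i. V i)"
      by (intro emeasure_mono cov) (auto simp: V_def)
    also have "\<dots> \<le> (\<Sum>i. emeasure lborel (V i))"
      by (intro emeasure_subadditive_countably) (auto simp: V_def)
    also have "\<dots> \<le> (\<Sum>i. ennreal C * diam_pow s (U i))"
      using V by (intro suminf_le) auto
    also have "\<dots> = ennreal C * (\<Sum>i. diam_pow s (U i))" by simp
    finally have "ennreal (1 / C) * 1 \<le> ennreal (1 / C) * (ennreal C * (\<Sum>i. diam_pow s (U i)))"
      by (rule mult_left_mono) simp
    also have "\<dots> = (ennreal (1 / C) * ennreal C) * (\<Sum>i. diam_pow s (U i))"
      by (simp only: mult.assoc)
    also have "ennreal (1 / C) * ennreal C = 1"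
      using assms by (simp flip: ennreal_mult)
    finally show ?thesis by simp
  qed
  then have "ennreal (1 / C) \<le> hausdorff_pre s 1 A"
    unfolding hausdorff_pre_def by (intro INF_greatest)
  also have "\<dots> \<le> hausdorff_measure s A"
    unfolding hausdorff_measure_eq_SUP by (intro SUP_upper) auto
  finally show ?thesis .
qed

section \<open>The distribution function of the self-similar measure\<close>

text \<open>A discrete intermediate value argument, applied below to the points \<open>b k\<close>
  and to the cumulative masses of the pieces.\<close>

lemma ex_bracketing_index:
  fixes s :: "nat \<Rightarrow> 'a::linorder"
  assumes "0 < n" "s n \<le> y" "y \<le> s 0"
  shows "\<exists>k\<in>{1..n}. s k \<le> y \<and> y \<le> s (k - 1)"
  using assms
proof (induction n)
  case (Suc n)
  show ?case
  proof (cases "0 < n \<and> s n \<le> y")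
    case True
    then obtain k where "k \<in> {1..n}" "s k \<le> y \<and> y \<le> s (k - 1)" using Suc by blast
    then show ?thesis by (intro bexI[of _ k]) auto
  next
    case False
    then have "y \<le> s n" using Suc.prems by (cases "n = 0") auto
    then show ?thesis using Suc.prems by (intro bexI[of _ "Suc n"]) auto
  qed
qed simp

text \<open>What the two families share. Convexity makes the gaps decrease, so that among the first
  \<open>n\<close> gaps the first is the largest and the last the smallest.\<close>

locale convex_sequence =
  fixes b :: "nat \<Rightarrow> real" and K :: real
  assumes b_0: "b 0 = 1" and b_pos: "0 < b k" and b_Suc_less: "b (Suc k) < b k"
    and b_convex: "b (Suc k) - b (Suc (Suc k)) \<le> b k - b (Suc k)"
    and b_ratio: "b k \<le> K * b (Suc k)"
begin

text \<open>For \<open>k \<ge> 1\<close> this is the contraction ratio of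
  \<open>g b k\<close>.\<close>

definition a :: "nat \<Rightarrow> real" where "a k = b (k - 1) - b k"

lemma b_antimono: "i \<le> j \<Longrightarrow> b j \<le> b i"
  by (rule lift_Suc_antimono_le[of b, OF less_imp_le[OF b_Suc_less]])

lemma b_le_1: "b k \<le> 1"
  using b_antimono[of 0 k] b_0 by simp

lemma a_pos: "1 \<le> k \<Longrightarrow> 0 < a k"
  using b_Suc_less[of "k - 1"] by (simp add: a_def)

lemma a_antimono:
  assumes "1 \<le> i" "i \<le> j" shows "a j \<le> a i"
  using assms(2)
proof (induction j rule: dec_induct)
  case (step m)
  then obtain m' where "m = Suc m'" using assms(1) by (cases m) auto
  then have "a (Suc m) \<le> a m" using b_convex[of m'] by (simp add: a_def)
  with step show ?case by linarith
qed simp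

lemma a_1: "a 1 < 1"
  using b_pos[of 1] by (simp add: a_def b_0)

lemma sum_a: "i \<le> j \<Longrightarrow> sum a {i<..j} = b i - b j"
proof (induction j rule: dec_induct)
  case (step m)
  then have "{i<..Suc m} = insert (Suc m) {i<..m}" by auto
  with step show ?case by (simp add: a_def)
qed simp

lemma K_ge_1: "1 \<le> K"
proof (rule ccontr)
  assume "\<not> 1 \<le> K"
  then have "K * b 1 < 1 * b 1" using b_pos[of 1] by (intro mult_strict_right_mono) auto
  then show False using b_ratio[of 0] b_Suc_less[of 0] by simp
qed

end

text \<open>\<open>moran\<close> makes \<open>h\<close> the similarity dimension;
  \<open>hausdorff_dim_J\<close> identifies it with the Hausdorff dimension.\<close>

locale convex_ifs = convex_sequence +
  fixes n :: nat and h :: real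
  assumes h: "0 < h" "h \<le> 1"
    and moran: "(\<Sum>k=1..n. a k powr h) = 1"
begin

text \<open>The weights of the self-similar probability measure.\<close>

definition c :: "nat \<Rightarrow> real" where "c k = a k powr h"

definition \<kappa> :: real where "\<kappa> = a n powr (h - 1)"

text \<open>The constant for which the estimates of \<open>linear\<close> below reproduce themselves under
  \<open>T\<close>; it tends to 1 with \<open>\<kappa>\<close>.\<close>

definition A :: real where "A = \<kappa> + (K - 1) * (\<kappa> - 1 / \<kappa>)"

lemma n_pos: "1 \<le> n"
proof (rule ccontr)
  assume "\<not> 1 \<le> n"
  then have "n = 0" by simp
  with moran show False by simp
qed

lemma c_pos: "1 \<le> k \<Longrightarrow> 0 < c k"
  using a_pos[of k] by (simp add: c_def)

lemma sum_c: "sum c {1..n} = 1"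
  using moran by (simp add: c_def)

lemma \<kappa>_ge_1: "1 \<le> \<kappa>"
proof -
  have "a n \<le> 1" using a_antimono[of 1 n] a_1 n_pos by simp
  then show ?thesis using h a_pos[OF n_pos] powr_mono2'[of "1 - h" "a n" 1]
    powr_mono'[of "h - 1" 0 "a n"]
    by (simp add: \<kappa>_def)
qed

text \<open>The ratio of mass to length is \<open>a k powr (h - 1)\<close>; as
  \<open>h \<le> 1\<close>, it is largest at the smallest gap \<open>a n\<close>.\<close>

lemma c_le:
  assumes "k \<in> {1..n}" shows "c k \<le> \<kappa> * a k"
proof -
  have "a k powr (h - 1) \<le> \<kappa>"
    unfolding \<kappa>_def using assms a_antimono[of k n] a_pos[of n] h
    by (intro powr_mono2') auto
  then have "a k powr (h - 1) * a k \<le> \<kappa> * a k"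
    using a_pos[of k] assms by (intro mult_right_mono) auto
  moreover have "a k powr (h - 1) * a k = c k"
    using a_pos[of k] assms by (simp add: c_def powr_diff)
  ultimately show ?thesis by simp
qed

lemma sum_c_le:
  assumes "i \<le> j" "j \<le> n" shows "sum c {i<..j} \<le> \<kappa> * (b i - b j)"
proof -
  have "sum c {i<..j} \<le> (\<Sum>k\<in>{i<..j}. \<kappa> * a k)"
    using assms by (intro sum_mono c_le) auto
  also have "\<dots> = \<kappa> * (b i - b j)"
    by (simp only: sum_distrib_left[symmetric] sum_a[OF assms(1)])
  finally show ?thesis .
qed

lemma A_ge_\<kappa>: "\<kappa> \<le> A"
proof -
  have "1 / \<kappa> \<le> 1" using \<kappa>_ge_1 by simp
  then have "1 / \<kappa> \<le> \<kappa>" using \<kappa>_ge_1 by linarith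
  then show ?thesis using K_ge_1 by (simp add: A_def)
qed

text \<open>If \<open>f\<close> is the distribution function of an atomless probability measure on
  \<open>[0,1]\<close>, then \<open>T f\<close> is that of the sum of its images under
  \<open>g b k\<close> with weights \<open>c k\<close>. These maps reverse orientation, hence
  \<open>1 - f\<close> at the preimage of \<open>x\<close>.\<close>

definition T :: "(real \<Rightarrow> real) \<Rightarrow> real \<Rightarrow> real" where
  "T f x = (\<Sum>k=1..n. c k * (1 - f ((b (k - 1) - x) / a k)))"

definition normalized :: "(real \<Rightarrow> real) \<Rightarrow> bool" where
  "normalized f \<longleftrightarrow> mono f \<and> (\<forall>u\<le>0. f u = 0) \<and> (\<forall>u\<ge>1. f u = 1)"

text \<open>The constants at the ends 0 and 1 differ: since the maps reverse orientation,
  \<open>T\<close> derives each bound from the other one.\<close>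

definition linear :: "(real \<Rightarrow> real) \<Rightarrow> bool" where
  "linear f \<longleftrightarrow> (\<forall>t\<ge>0. f t \<le> A * t) \<and> (\<forall>s\<ge>0. 1 - f (1 - s) \<le> \<kappa> * A * s)"

section \<open>Mapping properties of the operator \<open>T\<close>\<close>

lemma normalized_bounds:
  assumes "normalized f" shows "0 \<le> f u" "f u \<le> 1"
proof -
  have f: "mono f" "\<And>u. u \<le> 0 \<Longrightarrow> f u = 0" "\<And>u. 1 \<le> u \<Longrightarrow> f u = 1"
    using assms by (auto simp: normalized_def)
  show "0 \<le> f u" using monoD[OF f(1), of "min u 0" u] f(2)[of "min u 0"] by simp
  show "f u \<le> 1" using monoD[OF f(1), of u "max u 1"] f(3)[of "max u 1"] by simp
qed

lemma T_left: "normalized f \<Longrightarrow> x \<le> b n \<Longrightarrow> T f x = 0"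
  unfolding T_def
proof (intro sum.neutral ballI)
  fix k assume "normalized f" "x \<le> b n" "k \<in> {1..n}"
  then have "a k \<le> b (k - 1) - x" using b_antimono[of k n] by (simp add: a_def)
  then have "1 \<le> (b (k - 1) - x) / a k" using a_pos[of k] \<open>k \<in> {1..n}\<close> by simp
  then show "c k * (1 - f ((b (k - 1) - x) / a k)) = 0"
    using \<open>normalized f\<close> by (simp add: normalized_def)
qed

lemma T_right: "normalized f \<Longrightarrow> 1 \<le> x \<Longrightarrow> T f x = 1"
  unfolding T_def
proof (subst sum_c[symmetric], intro sum.cong refl)
  fix k assume "normalized f" "1 \<le> x" "k \<in> {1..n}"
  then have "(b (k - 1) - x) / a k \<le> 0"
    using a_pos[of k] b_le_1[of "k - 1"] by (simp add: divide_le_0_iff)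
  then show "c k * (1 - f ((b (k - 1) - x) / a k)) = c k"
    using \<open>normalized f\<close> by (simp add: normalized_def)
qed

lemma sum_split:
  fixes u :: "nat \<Rightarrow> real"
  assumes "k \<in> {1..n}"
  shows "sum u {1..n} = sum u {0<..k - 1} + u k + sum u {k<..n}"
proof -
  have "{1..n} = {0<..k - 1} \<union> insert k {k<..n}" using assms by auto
  moreover have "sum u \<dots> = sum u {0<..k - 1} + sum u (insert k {k<..n})"
    using assms by (intro sum.union_disjoint) auto
  ultimately show ?thesis by simp
qed

text \<open>Pieces with index below \<open>k\<close> lie to the right of \<open>x\<close> and
  contribute nothing; those with index above \<open>k\<close> lie to its left and contribute their
  whole mass.\<close>

lemma T_piece:
  assumes f: "normalized f" and k: "k \<in> {1..n}" and x: "b k \<le> x" "x \<le> b (k - 1)"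
  shows "T f x = c k * (1 - f ((b (k - 1) - x) / a k)) + sum c {k<..n}"
proof -
  have 1: "c l * (1 - f ((b (l - 1) - x) / a l)) = 0" if "l \<in> {0<..k - 1}" for l
  proof -
    have "a l \<le> b (l - 1) - x" using b_antimono[of l "k - 1"] that x by (simp add: a_def)
    then have "1 \<le> (b (l - 1) - x) / a l" using a_pos[of l] that by simp
    then show ?thesis using f by (simp add: normalized_def)
  qed
  have 2: "c l * (1 - f ((b (l - 1) - x) / a l)) = c l" if "l \<in> {k<..n}" for l
  proof -
    have "k \<le> l - 1" using that by auto
    then have "b (l - 1) - x \<le> 0" using b_antimono[of k "l - 1"] x by simp
    then have "(b (l - 1) - x) / a l \<le> 0" using a_pos[of l] that by (simp add: divide_le_0_iff)
    then show ?thesis using f by (simp add: normalized_def)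
  qed
  have "(\<Sum>l\<in>{0<..k - 1}. c l * (1 - f ((b (l - 1) - x) / a l))) = 0"
    using 1 by (intro sum.neutral) blast
  moreover have "(\<Sum>l\<in>{k<..n}. c l * (1 - f ((b (l - 1) - x) / a l))) = sum c {k<..n}"
    using 2 by (intro sum.cong refl)
  ultimately show ?thesis
    unfolding T_def sum_split[OF k] by linarith
qed

lemma ex_piece:
  assumes "b n \<le> x" "x \<le> 1"
  obtains k where "k \<in> {1..n}" "b k \<le> x" "x \<le> b (k - 1)"
  using ex_bracketing_index[of n b x] assms n_pos b_0 by auto

lemma T_normalized:
  assumes "normalized f" shows "normalized (T f)"
proof -
  have "T f x \<le> T f y" if "x \<le> y" for x y
    unfolding T_def
  proof (intro sum_mono mult_left_mono)
    fix k assume k: "k \<in> {1..n}"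
    then have "(b (k - 1) - y) / a k \<le> (b (k - 1) - x) / a k"
      using that a_pos[of k] by (intro divide_right_mono) auto
    then show "1 - f ((b (k - 1) - x) / a k) \<le> 1 - f ((b (k - 1) - y) / a k)"
      using assms by (auto simp: normalized_def dest: monoD)
    show "0 \<le> c k" using c_pos[of k] k by simp
  qed
  moreover have "T f u = 0" if "u \<le> 0" for u
    using T_left[OF assms, of u] that b_pos[of n] by simp
  ultimately show ?thesis
    using T_right[OF assms] by (simp add: normalized_def mono_def)
qed

text \<open>Cut at the piece containing the point. Whole pieces cost a factor \<kappa>; the partial
  piece is the image of an interval at the opposite end, where the bound for \<open>f\<close>
  applies. Near 1 the constants match at once; near 0 a factor \<open>\<kappa>\<^sup>2\<close> has
  to be recovered, which the choice of \<open>A\<close> makes possible.\<close>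

lemma T_linear:
  assumes f: "normalized f" "linear f" shows "linear (T f)"
  unfolding linear_def
proof (intro conjI allI impI)
  note \<kappa> = \<kappa>_ge_1 and A = A_ge_\<kappa>
  fix t :: real assume t: "0 \<le> t"
  consider "t \<le> b n" | "1 \<le> t" | "b n \<le> t" "t \<le> 1" by linarith
  then show "T f t \<le> A * t"
  proof cases
    case 1
    then show ?thesis using T_left[OF f(1) 1] t A \<kappa> by simp
  next
    case 2
    have "1 * 1 \<le> A * t" using 2 A \<kappa> by (intro mult_mono) auto
    then show ?thesis using T_right[OF f(1) 2] by simp
  next
    case 3
    then obtain k where k: "k \<in> {1..n}" "b k \<le> t" "t \<le> b (k - 1)" by (rule ex_piece)
    have ak: "0 < a k" using a_pos k by simp
    define s where "s = (t - b k) / a k"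
    define G where "G = 1 - f (1 - s)"
    have s: "0 \<le> s" using ak k by (simp add: s_def)
    have t_eq: "t = b k + a k * s" using ak by (simp add: s_def)
    have "(b (k - 1) - t) / a k = 1 - s" using ak by (simp add: s_def a_def field_simps)
    then have "T f t = c k * G + sum c {k<..n}"
      using T_piece[OF f(1) k] by (simp add: G_def)
    also have "\<dots> \<le> \<kappa> * a k * G + \<kappa> * b k"
    proof (intro add_mono mult_right_mono c_le k)
      show "0 \<le> G" using normalized_bounds[OF f(1)] by (simp add: G_def)
      have "sum c {k<..n} \<le> \<kappa> * (b k - b n)" using k by (intro sum_c_le) auto
      also have "\<dots> \<le> \<kappa> * b k" using \<kappa> b_pos[of n] by (intro mult_left_mono) auto
      finally show "sum c {k<..n} \<le> \<kappa> * b k" .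
    qed
    also have "\<dots> \<le> A * t"
    proof -
      \<comment> \<open>Interpolates between \<open>G \<le> 1\<close> and
        \<open>G \<le> \<kappa> * A * s\<close>; the weight \<open>1 / \<kappa>\<^sup>2\<close> on
        the latter cancels both surplus factors \<kappa>.\<close>
      define \<theta> where "\<theta> = 1 - 1 / \<kappa>\<^sup>2"
      have \<theta>: "0 \<le> \<theta>" "\<theta> \<le> 1" using \<kappa> by (auto simp: \<theta>_def)
      have "G \<le> 1" using normalized_bounds[OF f(1)] by (simp add: G_def)
      moreover have "G \<le> \<kappa> * A * s" using f(2) s by (simp add: linear_def G_def)
      ultimately have "\<theta> * G + (1 - \<theta>) * G \<le> \<theta> * 1 + (1 - \<theta>) * (\<kappa> * A * s)"
        using \<theta> by (intro add_mono mult_left_mono) auto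
      moreover have "(1 - \<theta>) * (\<kappa> * A * s) = A * s / \<kappa>"
        using \<kappa> by (simp add: \<theta>_def power2_eq_square)
      ultimately have "G \<le> \<theta> + A * s / \<kappa>" by (simp add: algebra_simps)
      then have "\<kappa> * a k * G + \<kappa> * b k \<le> \<kappa> * a k * (\<theta> + A * s / \<kappa>) + \<kappa> * b k"
        using \<kappa> ak by (intro add_right_mono mult_left_mono) auto
      also have "\<dots> = \<kappa> * \<theta> * a k + (\<kappa> / \<kappa>) * (A * (a k * s)) + \<kappa> * b k"
        by (simp add: algebra_simps)
      also have "\<kappa> / \<kappa> = 1" using \<kappa> by simp
      \<comment> \<open>The share left over from \<open>G \<le> 1\<close> is paid for by the
        distance of the piece from 0, as \<open>a k \<le> (K - 1) * b k\<close>.\<close>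
      also have "\<kappa> * \<theta> * a k \<le> \<kappa> * \<theta> * ((K - 1) * b k)"
        using b_ratio[of "k - 1"] k \<kappa> \<theta> by (intro mult_left_mono) (auto simp: a_def algebra_simps)
      also have "\<kappa> * \<theta> * ((K - 1) * b k) + 1 * (A * (a k * s)) + \<kappa> * b k = A * t"
      proof -
        have "\<kappa> * \<theta> = \<kappa> - 1 / \<kappa>"
          using \<kappa> by (simp add: \<theta>_def power2_eq_square right_diff_distrib)
        then have "A = \<kappa> + (K - 1) * (\<kappa> * \<theta>)" by (simp only: A_def)
        then have "A * t = (\<kappa> + (K - 1) * (\<kappa> * \<theta>)) * b k + A * (a k * s)"
          by (simp only: t_eq distrib_left)
        then show ?thesis by (simp add: algebra_simps)
      qed
      finally show ?thesis by simp
    qed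
    finally show ?thesis .
  qed
next
  note \<kappa> = \<kappa>_ge_1 and A = A_ge_\<kappa>
  fix s :: real assume s: "0 \<le> s"
  have lin: "\<kappa> * s \<le> \<kappa> * A * s"
  proof -
    have "\<kappa> * s * 1 \<le> \<kappa> * s * A" using \<kappa> A s by (intro mult_left_mono) auto
    then show ?thesis by (simp add: mult_ac)
  qed
  show "1 - T f (1 - s) \<le> \<kappa> * A * s"
  proof (cases "b n \<le> 1 - s")
    \<comment> \<open>All pieces lie to the right of \<open>1 - s\<close>, so the whole mass 1 sits
      on a length of at most \<open>s\<close>.\<close>
    case False
    have "{0<..n} = {1..n}" by auto
    then have "1 = sum c {0<..n}" using sum_c by simp
    also have "\<dots> \<le> \<kappa> * (1 - b n)" using sum_c_le[of 0 n] b_0 by simp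
    also have "\<dots> \<le> \<kappa> * s" using False \<kappa> by (intro mult_left_mono) auto
    finally show ?thesis using lin T_left[OF f(1)] False by simp
  next
    case True
    moreover have "1 - s \<le> 1" using s by simp
    ultimately obtain k where k: "k \<in> {1..n}" "b k \<le> 1 - s" "1 - s \<le> b (k - 1)" by (rule ex_piece)
    have ak: "0 < a k" using a_pos k by simp
    define t where "t = (b (k - 1) - (1 - s)) / a k"
    have t: "0 \<le> t" using ak k by (simp add: t_def)
    have s_eq: "s = 1 - b (k - 1) + a k * t" using ak by (simp add: t_def)
    have "T f (1 - s) = c k * (1 - f t) + sum c {k<..n}"
      unfolding t_def by (rule T_piece[OF f(1) k])
    then have "1 - T f (1 - s) = sum c {0<..k - 1} + c k * f t"
      using sum_split[OF k(1), of c] sum_c by (simp add: right_diff_distrib)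
    also have "\<dots> \<le> \<kappa> * (1 - b (k - 1)) + \<kappa> * a k * f t"
      using sum_c_le[of 0 "k - 1"] k c_le[OF k(1)] normalized_bounds[OF f(1), of t]
      by (intro add_mono mult_right_mono) (auto simp: b_0)
    also have "\<dots> \<le> \<kappa> * (A * (1 - b (k - 1))) + \<kappa> * a k * (A * t)"
    proof (intro add_mono mult_left_mono)
      show "1 - b (k - 1) \<le> A * (1 - b (k - 1))"
        using \<kappa> A b_le_1[of "k - 1"] mult_right_mono[of 1 A "1 - b (k - 1)"] by simp
      show "f t \<le> A * t" using f(2) t by (simp add: linear_def)
    qed (use \<kappa> ak in auto)
    also have "\<dots> = \<kappa> * A * s" unfolding s_eq by (simp add: algebra_simps)
    finally show ?thesis .
  qed
qed

text \<open>At each point at most one piece has a nonconstant contribution, so the factor is a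
  single weight instead of the sum of all weights, which is 1.\<close>

lemma T_contraction:
  assumes f: "normalized f" "normalized f'" and e: "\<And>u. \<bar>f u - f' u\<bar> \<le> e"
  shows "\<bar>T f x - T f' x\<bar> \<le> c 1 * e"
proof -
  have e0: "0 \<le> e" using e[of 0] by simp
  consider "x \<le> b n" | "1 \<le> x" | "b n \<le> x" "x \<le> 1" by linarith
  then show ?thesis
  proof cases
    case 3
    then obtain k where k: "k \<in> {1..n}" "b k \<le> x" "x \<le> b (k - 1)" by (rule ex_piece)
    let ?t = "(b (k - 1) - x) / a k"
    have "T f x - T f' x = c k * (f' ?t - f ?t)"
      using T_piece[OF f(1) k] T_piece[OF f(2) k] by (simp add: algebra_simps)
    then have "\<bar>T f x - T f' x\<bar> = c k * \<bar>f ?t - f' ?t\<bar>"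
      using c_pos[of k] k by (simp add: abs_mult abs_minus_commute)
    also have "\<dots> \<le> c 1 * e"
    proof (intro mult_mono e)
      show "c k \<le> c 1" unfolding c_def using a_antimono[of 1 k] a_pos[of k] k h
        by (intro powr_mono2) auto
    qed (use c_pos[of 1] in auto)
    finally show ?thesis .
  next
    case 1
    show ?thesis unfolding T_left[OF f(1) 1] T_left[OF f(2) 1] using e0 c_pos[of 1] by simp
  next
    case 2
    show ?thesis unfolding T_right[OF f(1) 2] T_right[OF f(2) 2] using e0 c_pos[of 1] by simp
  qed
qed

section \<open>The fixed point as a limit of iterates\<close>

definition F_approx :: "nat \<Rightarrow> real \<Rightarrow> real" where
  "F_approx l = (T ^^ l) (\<lambda>x. max 0 (min 1 x))"

definition F :: "real \<Rightarrow> real" where "F x = lim (\<lambda>l. F_approx l x)"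

lemma F_approx_Suc: "F_approx (Suc l) = T (F_approx l)"
  by (simp add: F_approx_def)

lemma F_approx_normalized: "normalized (F_approx l)"
proof (induction l)
  case 0
  have "mono (\<lambda>x::real. max 0 (min 1 x))" by (intro monoI max.mono min.mono order_refl)
  then show ?case by (simp add: F_approx_def normalized_def max_def min_def)
qed (simp add: F_approx_Suc T_normalized)

lemma F_approx_linear: "linear (F_approx l)"
proof (induction l)
  case 0
  have A: "1 \<le> A" using \<kappa>_ge_1 A_ge_\<kappa> by linarith
  then have \<kappa>A: "1 \<le> \<kappa> * A" using \<kappa>_ge_1 mult_mono[of 1 \<kappa> 1 A] by simp
  have *: "max 0 (min 1 t) \<le> B * t" if "0 \<le> t" "1 \<le> B" for t B :: real
  proof -
    have "max 0 (min 1 t) \<le> 1 * t" using that(1) by simp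
    also have "\<dots> \<le> B * t" using that by (intro mult_right_mono)
    finally show ?thesis .
  qed
  have "1 - max 0 (min 1 (1 - s)) = max 0 (min 1 s)" for s :: real
    by (simp add: max_def min_def)
  then show ?case
    using *[OF _ A] *[OF _ \<kappa>A] by (simp only: F_approx_def linear_def funpow_0) blast
qed (simp add: F_approx_Suc T_linear F_approx_normalized)

lemma c_1: "c 1 < 1"
  using a_1 a_pos[of 1] h powr_less_mono2[of h "a 1" 1] by (simp add: c_def)

text \<open>By the contraction property the telescoping series of increments is dominated by the
  geometric series in \<open>c 1 < 1\<close>.\<close>

lemma F_approx_tendsto: "(\<lambda>l. F_approx l x) \<longlonglongrightarrow> F x"
proof -
  have step: "\<bar>F_approx (Suc l) x - F_approx l x\<bar> \<le> c 1 ^ l" for l x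
  proof (induction l arbitrary: x)
    case 0
    show ?case using normalized_bounds[OF F_approx_normalized[of 0], of x]
        normalized_bounds[OF F_approx_normalized[of 1], of x] by (simp add: abs_le_iff)
  next
    case (Suc l)
    then show ?case
      using T_contraction[OF F_approx_normalized F_approx_normalized Suc]
      by (simp add: F_approx_Suc)
  qed
  have "summable (\<lambda>l. F_approx (Suc l) x - F_approx l x)"
  proof (rule summable_comparison_test')
    show "summable (\<lambda>l. c 1 ^ l)" using c_1 c_pos[of 1] by (intro summable_geometric) simp
    show "norm (F_approx (Suc l) x - F_approx l x) \<le> c 1 ^ l" if "0 \<le> l" for l
      using step by simp
  qed
  then have "convergent (\<lambda>l. F_approx l x - F_approx 0 x)"
    by (simp only: summable_iff_convergent sum_lessThan_telescope[of "\<lambda>l. F_approx l x"])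
  then have "convergent (\<lambda>l. F_approx l x)"
    using convergent_add[OF _ convergent_const[of "F_approx 0 x"]] by force
  then show ?thesis by (simp add: F_def convergent_LIMSEQ_iff)
qed

lemma F_normalized: "normalized F"
proof -
  have "F x \<le> F y" if "x \<le> y" for x y
    using F_approx_normalized that
    by (intro LIMSEQ_le[OF F_approx_tendsto F_approx_tendsto]) (auto simp: normalized_def mono_def)
  moreover have "F u = 0" if "u \<le> 0" for u
    using F_approx_normalized that F_approx_tendsto[of u]
    by (simp add: normalized_def LIMSEQ_const_iff)
  moreover have "F u = 1" if "1 \<le> u" for u
    using F_approx_normalized that F_approx_tendsto[of u]
    by (simp add: normalized_def LIMSEQ_const_iff)
  ultimately show ?thesis by (simp add: normalized_def mono_def)
qed

lemma F_linear: "linear F"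
proof -
  have "F t \<le> A * t" if "0 \<le> t" for t
    using F_approx_linear that
    by (intro LIMSEQ_le_const2[OF F_approx_tendsto]) (auto simp: linear_def)
  moreover have "1 - F (1 - s) \<le> \<kappa> * A * s" if "0 \<le> s" for s
    using F_approx_linear that
    by (intro LIMSEQ_le_const2[OF tendsto_diff[OF tendsto_const F_approx_tendsto]])
      (auto simp: linear_def)
  ultimately show ?thesis by (simp add: linear_def)
qed

lemma F_fixpoint: "T F = F"
proof
  fix x
  have "(\<lambda>l. T (F_approx l) x) \<longlonglongrightarrow> T F x"
    unfolding T_def by (intro tendsto_intros F_approx_tendsto)
  moreover have "(\<lambda>l. T (F_approx l) x) \<longlonglongrightarrow> F x"
    using LIMSEQ_Suc[OF F_approx_tendsto[of x]] by (simp add: F_approx_Suc)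
  ultimately show "T F x = F x" by (rule LIMSEQ_unique)
qed

text \<open>Self-similarity: on each piece \<open>F\<close> is a reversed and rescaled copy of
  itself, raised by the mass to the left.\<close>

lemmas F_piece = T_piece[OF F_normalized, unfolded F_fixpoint]

end

section \<open>Hoelder continuity\<close>

context convex_ifs
begin

lemma sum_c_join: "i \<le> m \<Longrightarrow> m \<le> j \<Longrightarrow> sum c {i<..m} + sum c {m<..j} = sum c {i<..j}"
  by (subst sum.union_disjoint[symmetric]) (auto intro: sum.cong)

lemma F_mono: "x \<le> y \<Longrightarrow> F x \<le> F y"
  using F_normalized by (simp add: normalized_def mono_def)

lemma F_eq_0: "x \<le> b n \<Longrightarrow> F x = 0"
  using T_left[OF F_normalized] by (simp add: F_fixpoint)

lemma F_eq_1: "1 \<le> x \<Longrightarrow> F x = 1"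
  using F_normalized by (simp add: normalized_def)

lemma F_b:
  assumes "m \<in> {1..n}" shows "F (b m) = sum c {m<..n}"
proof -
  have "(b (m - 1) - b m) / a m = 1" using a_pos[of m] assms by (simp add: a_def)
  then show ?thesis
    using F_piece[of m "b m"] b_antimono[of "m - 1" m] F_eq_1[of 1] assms by simp
qed

text \<open>\<open>[x, b m]\<close> consists of whole pieces and the right end of the piece
  containing \<open>x\<close>. That end is the image of some \<open>[0, t]\<close>, so the bound at
  0 applies.\<close>

lemma F_diff_left:
  assumes m: "m \<in> {1..n}" and x: "x \<le> b m"
  shows "F (b m) - F x \<le> \<kappa> * A * (b m - x)"
proof (cases "b n \<le> x")
  case False
  have "F (b m) - F x \<le> \<kappa> * (b m - b n)"
    using F_b[OF m] F_eq_0[of x] False sum_c_le[of m n] m by simp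
  also have "\<dots> \<le> \<kappa> * (A * (b m - x))"
  proof (intro mult_left_mono)
    have "1 * (b m - b n) \<le> A * (b m - x)"
      using False \<kappa>_ge_1 A_ge_\<kappa> b_antimono[of m n] m by (intro mult_mono) auto
    then show "b m - b n \<le> A * (b m - x)" by simp
  qed (use \<kappa>_ge_1 in simp)
  finally show ?thesis by (simp add: mult.assoc)
next
  case True
  moreover have "x \<le> 1" using x b_le_1[of m] by simp
  ultimately obtain j where j: "j \<in> {1..n}" "b j \<le> x" "x \<le> b (j - 1)" by (rule ex_piece)
  show ?thesis
  proof (cases "m < j")
    \<comment> \<open>If \<open>j \<le> m\<close>, then \<open>x\<close> can only be the endpoint
      \<open>b m\<close>.\<close>
    case False
    then have "b m = x" using b_antimono[of j m] j x by simp
    then show ?thesis by simp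
  next
    case mj: True
    have aj: "0 < a j" using a_pos j by simp
    define t where "t = (b (j - 1) - x) / a j"
    have t: "0 \<le> t" "a j * t = b (j - 1) - x" using aj j by (simp_all add: t_def)
    have "F x = c j * (1 - F t) + sum c {j<..n}"
      unfolding t_def by (rule F_piece[OF j])
    moreover have "F (b m) = sum c {m<..j - 1} + c j + sum c {j<..n}"
    proof -
      have "{j - 1<..j} = {j}" "m \<le> j - 1" "j - 1 \<le> n" using j mj by auto
      then show ?thesis
        using F_b[OF m] sum_c_join[of m "j - 1" n] sum_c_join[of "j - 1" j n] mj j by simp
    qed
    ultimately have "F (b m) - F x = sum c {m<..j - 1} + c j * F t"
      by (simp add: right_diff_distrib)
    also have "\<dots> \<le> \<kappa> * (b m - b (j - 1)) + \<kappa> * a j * (A * t)"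
    proof (intro add_mono mult_mono)
      show "sum c {m<..j - 1} \<le> \<kappa> * (b m - b (j - 1))" using mj j by (intro sum_c_le) auto
      show "F t \<le> A * t" using F_linear t by (simp add: linear_def)
    qed (use c_le[OF j(1)] normalized_bounds(1)[OF F_normalized] aj \<kappa>_ge_1 in simp_all)
    also have "\<dots> \<le> \<kappa> * (A * (b m - b (j - 1))) + \<kappa> * a j * (A * t)"
    proof (intro add_right_mono mult_left_mono)
      show "b m - b (j - 1) \<le> A * (b m - b (j - 1))"
        using \<kappa>_ge_1 A_ge_\<kappa> b_antimono[of m "j - 1"] mj
          mult_right_mono[of 1 A "b m - b (j - 1)"] by simp
    qed (use \<kappa>_ge_1 in simp)
    also have "\<dots> = \<kappa> * A * (b m - b (j - 1) + a j * t)" by (simp add: algebra_simps)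
    also have "\<dots> = \<kappa> * A * (b m - x)" by (simp add: t)
    finally show ?thesis .
  qed
qed

text \<open>Here the partial piece is a left end, the image of some \<open>[1 - s, 1]\<close>; the
  weaker bound at 1 costs one more factor \<kappa>.\<close>

lemma F_diff_right:
  assumes m: "m \<in> {1..n}" and y: "b m \<le> y" "y \<le> 1"
  shows "F y - F (b m) \<le> \<kappa> * \<kappa> * A * (y - b m)"
proof -
  have "b n \<le> y" using b_antimono[of m n] m y by simp
  then obtain i where i: "i \<in> {1..n}" "b i \<le> y" "y \<le> b (i - 1)" using y(2) by (rule ex_piece)
  show ?thesis
  proof (cases "i \<le> m")
    case False
    then have "m \<le> i - 1" by simp
    then have "y = b m" using b_antimono[of m "i - 1"] i y by simp
    then show ?thesis by simp
  next
    case im: True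
    have ai: "0 < a i" using a_pos i by simp
    define s where "s = (y - b i) / a i"
    have s: "0 \<le> s" "a i * s = y - b i" using ai i by (simp_all add: s_def)
    have "(b (i - 1) - y) / a i = 1 - s" using ai by (simp add: s_def a_def field_simps)
    then have "F y = c i * (1 - F (1 - s)) + sum c {i<..n}"
      using F_piece[OF i] by simp
    then have "F y - F (b m) = sum c {i<..m} + c i * (1 - F (1 - s))"
      using F_b[OF m] sum_c_join[of i m n] im m by simp
    also have "\<dots> \<le> \<kappa> * (b i - b m) + \<kappa> * a i * (\<kappa> * A * s)"
    proof (intro add_mono mult_mono)
      show "sum c {i<..m} \<le> \<kappa> * (b i - b m)" using im m by (intro sum_c_le) auto
      show "1 - F (1 - s) \<le> \<kappa> * A * s" using F_linear s by (simp add: linear_def)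
    qed (use c_le[OF i(1)] normalized_bounds(2)[OF F_normalized] ai \<kappa>_ge_1 in simp_all)
    also have "\<dots> \<le> \<kappa> * (\<kappa> * A * (b i - b m)) + \<kappa> * a i * (\<kappa> * A * s)"
    proof (intro add_right_mono mult_left_mono)
      have "1 * 1 \<le> \<kappa> * A" using \<kappa>_ge_1 A_ge_\<kappa> by (intro mult_mono) auto
      then show "b i - b m \<le> \<kappa> * A * (b i - b m)"
        using b_antimono[of i m] im mult_right_mono[of 1 "\<kappa> * A" "b i - b m"] by simp
    qed (use \<kappa>_ge_1 in simp)
    also have "\<dots> = \<kappa> * \<kappa> * A * (b i - b m + a i * s)" by (simp add: algebra_simps)
    also have "\<dots> = \<kappa> * \<kappa> * A * (y - b m)" by (simp add: s)
    finally show ?thesis .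
  qed
qed

text \<open>The larger of the constants in \<open>F_diff_left\<close> and
  \<open>F_diff_right\<close>.\<close>

definition C :: real where "C = \<kappa> * \<kappa> * A"

lemma C_ge_1: "1 \<le> C"
proof -
  have "1 * 1 * 1 \<le> \<kappa> * \<kappa> * A" using \<kappa>_ge_1 A_ge_\<kappa> by (intro mult_mono) auto
  then show ?thesis by (simp add: C_def)
qed

lemma le_powr_h:
  assumes "0 \<le> t" "t \<le> 1" shows "t \<le> t powr h"
  using assms h powr_mono'[of h 1 t] by simp

text \<open>The two linear bounds meet at \<open>b m\<close>; on lengths up to 1 a linear bound
  implies the Hoelder bound.\<close>

lemma F_diff_straddling:
  assumes m: "m \<in> {1..n}" and xy: "0 \<le> x" "x \<le> b m" "b m \<le> y" "y \<le> 1"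
  shows "F y - F x \<le> C * (y - x) powr h"
proof -
  have "\<kappa> * A * (b m - x) * 1 \<le> \<kappa> * A * (b m - x) * \<kappa>"
    using \<kappa>_ge_1 A_ge_\<kappa> xy by (intro mult_left_mono) auto
  then have "F (b m) - F x \<le> C * (b m - x)"
    using F_diff_left[OF m xy(2)] by (simp add: C_def mult_ac)
  moreover have "F y - F (b m) \<le> C * (y - b m)"
    using F_diff_right[OF m xy(3,4)] by (simp add: C_def)
  ultimately have "F y - F x \<le> C * (y - x)" by (simp add: algebra_simps)
  also have "\<dots> \<le> C * (y - x) powr h"
    using C_ge_1 xy by (intro mult_left_mono le_powr_h) auto
  finally show ?thesis .
qed

text \<open>An interval inside a single first-level piece is rescaled until it straddles some \<open>b m\<close>.\<close>

lemma F_Hoelder_unit: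
  assumes "0 \<le> x" "x \<le> y" "y \<le> 1" "a 1 ^ N \<le> y - x"
  shows "F y - F x \<le> C * (y - x) powr h"
  using assms
\<comment> \<open>Rescaling stretches by \<open>1 / a k \<ge> 1 / a 1\<close>, so the lower bound on
  the length improves from \<open>a 1 ^ Suc N\<close> to \<open>a 1 ^ N\<close>. At
  \<open>N = 0\<close> only \<open>[0,1]\<close> is left.\<close>
proof (induction N arbitrary: x y)
  case 0
  then have "x = 0" "y = 1" by simp_all
  then show ?case using F_eq_1[of 1] F_eq_0[of 0] b_pos[of n] C_ge_1 by simp
next
  case (Suc N)
  have a1: "0 < a 1" using a_pos by simp
  show ?case
  proof (cases "\<exists>m\<in>{1..n}. x \<le> b m \<and> b m \<le> y")
    case True
    then show ?thesis using F_diff_straddling Suc.prems by blast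
  next
    case False
    note no = this
    show ?thesis
    proof (cases "b n \<le> y")
      case False
      then show ?thesis using F_eq_0[of x] F_eq_0[of y] Suc.prems C_ge_1 by simp
    next
      case True
      then obtain k where k: "k \<in> {1..n}" "b k \<le> y" "y \<le> b (k - 1)"
        using Suc.prems(3) by (rule ex_piece)
      then have x: "b k \<le> x" "x \<le> b (k - 1)" using no Suc.prems(2) by force+
      have ak: "0 < a k" using a_pos k by simp
      define x' y' where "x' = (b (k - 1) - y) / a k" and "y' = (b (k - 1) - x) / a k"
      have diff: "y' - x' = (y - x) / a k" by (simp add: x'_def y'_def diff_divide_distrib)
      have "F y' - F x' \<le> C * (y' - x') powr h"
      proof (rule Suc.IH)
        show "0 \<le> x'" "x' \<le> y'" "y' \<le> 1"
          using ak k x Suc.prems by (auto simp: x'_def y'_def divide_right_mono a_def)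
        have "a 1 ^ N * a k \<le> a 1 ^ N * a 1"
          using a_antimono[of 1 k] k a1 by (intro mult_left_mono) auto
        also have "\<dots> \<le> y - x" using Suc.prems(4) by (simp add: mult.commute)
        finally show "a 1 ^ N \<le> y' - x'" using ak by (simp add: diff pos_le_divide_eq)
      qed
      then have "c k * (F y' - F x') \<le> c k * (C * (y' - x') powr h)"
        using c_pos[of k] k by (intro mult_left_mono) auto
      moreover have "F y - F x = c k * (F y' - F x')"
        using F_piece[OF k] F_piece[OF k(1) x] by (simp add: x'_def y'_def right_diff_distrib)
      \<comment> \<open>The Hoelder constant is preserved exactly because
        \<open>c k = a k powr h\<close>.\<close>
      moreover have "c k * (C * (y' - x') powr h) = C * (y - x) powr h"
        using ak Suc.prems(2) by (simp add: diff c_def powr_divide)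
      ultimately show ?thesis by simp
    qed
  qed
qed

lemma F_Hoelder:
  assumes "x \<le> y"
  shows "F y - F x \<le> C * (y - x) powr h"
proof -
  \<comment> \<open>Clamping to \<open>[0,1]\<close> keeps the values of \<open>F\<close> and does
    not lengthen the interval.\<close>
  define x' y' where "x' = max 0 (min 1 x)" and "y' = max 0 (min 1 y)"
  have xy': "0 \<le> x'" "x' \<le> y'" "y' \<le> 1" "y' - x' \<le> y - x"
    using assms by (auto simp: x'_def y'_def max_def min_def)
  have clamp: "F u = F (max 0 (min 1 u))" for u
  proof -
    consider "u \<le> 0" | "1 \<le> u" | "0 \<le> u" "u \<le> 1" by linarith
    then show ?thesis
    proof cases
      case 1
      then show ?thesis using F_eq_0[of u] F_eq_0[of 0] b_pos[of n] by simp
    next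
      case 2
      then show ?thesis using F_eq_1[of u] F_eq_1[of 1] by simp
    qed simp
  qed
  have "F y' - F x' \<le> C * (y' - x') powr h"
  proof (cases "x' = y'")
    case False
    then have "0 < y' - x'" using xy' by simp
    moreover have "a 1 < 1" "0 < a 1" using a_1 a_pos by auto
    ultimately obtain N where "a 1 ^ N < y' - x'" using real_arch_pow_inv by blast
    then show ?thesis using xy' by (intro F_Hoelder_unit[of x' y' N]) auto
  qed simp
  also have "\<dots> \<le> C * (y - x) powr h"
    using xy' h C_ge_1 by (intro mult_left_mono powr_mono2) auto
  finally show ?thesis using clamp[of x] clamp[of y] by (simp add: x'_def y'_def)
qed

lemma F_continuous: "continuous_on S F"
proof -
  have bound: "\<bar>F y - F x\<bar> \<le> C * \<bar>y - x\<bar> powr h" for x y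
    using F_Hoelder[of x y] F_Hoelder[of y x] F_mono[of x y] F_mono[of y x]
    by (cases "x \<le> y") (auto simp: abs_if)
  have "(F \<longlongrightarrow> F x) (at x)" for x
  proof -
    have "((\<lambda>y. C * \<bar>y - x\<bar> powr h) \<longlongrightarrow> C * \<bar>x - x\<bar> powr h) (at x)"
      using h by (intro tendsto_intros) auto
    then have "((\<lambda>y. C * \<bar>y - x\<bar> powr h) \<longlongrightarrow> 0) (at x)" by simp
    then have "((\<lambda>y. F y - F x) \<longlongrightarrow> 0) (at x)"
      by (rule Lim_null_comparison[rotated]) (simp add: bound)
    then show ?thesis by (simp add: LIM_zero_cancel)
  qed
  then show ?thesis by (intro continuous_at_imp_continuous_on) (auto simp: isCont_def)
qed

end

section \<open>The limit set\<close>

lemma compose_word_Nil: "compose_word f [] = id"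
  and compose_word_Cons: "compose_word f (q # qs) = f q \<circ> compose_word f qs"
  by (simp_all add: compose_word_def)

context convex_ifs
begin

definition words :: "nat \<Rightarrow> nat list set" where
  "words l = {qs. length qs = l \<and> set qs \<subseteq> {1..n}}"

text \<open>The stages of the construction. Stage 0 is \<open>[0,1]\<close> and starts the
  inductions; \<open>J_eq\<close> intersects from stage 1 on.\<close>

definition level :: "nat \<Rightarrow> real set" where
  "level l = (\<Union>qs\<in>words l. compose_word (g b) qs ` {0..1})"

lemma J_eq: "J b n = (\<Inter>l\<in>{1..}. level l)"
  by (simp add: J_def limit_set_def level_def words_def)

lemma words_0: "words 0 = {[]}"
  by (auto simp: words_def)

lemma words_Suc: "words (Suc l) = (\<lambda>(k, qs). k # qs) ` ({1..n} \<times> words l)"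
  by (auto simp: words_def length_Suc_conv image_iff)

lemma finite_words: "finite (words l)"
  by (induction l) (simp_all add: words_0 words_Suc)

lemma level_0: "level 0 = {0..1}"
  by (simp add: level_def words_0 compose_word_Nil)

lemma level_Suc: "level (Suc l) = (\<Union>k\<in>{1..n}. g b k ` level l)"
proof -
  have "compose_word (g b) (case p of (k, qs) \<Rightarrow> k # qs) ` {0..1}
      = g b (fst p) ` compose_word (g b) (snd p) ` {0..1}" for p
    by (cases p) (simp add: compose_word_Cons image_comp)
  then have "level (Suc l) =
      (\<Union>p\<in>{1..n} \<times> words l. g b (fst p) ` compose_word (g b) (snd p) ` {0..1})"
    unfolding level_def words_Suc image_image by simp
  also have "\<dots> = (\<Union>k\<in>{1..n}. \<Union>qs\<in>words l. g b k ` compose_word (g b) qs ` {0..1})"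
    by (force simp del: atLeastAtMost_iff)
  finally show ?thesis by (simp only: level_def image_UN)
qed

lemma g_eq: "g b k x = b (k - 1) - a k * x"
  by (simp add: g_def a_def)

lemma g_bounds:
  assumes "k \<in> {1..n}" "x \<in> {0..1}"
  shows "b k \<le> g b k x" "g b k x \<le> b (k - 1)" "g b k x \<in> {0..1}"
proof -
  have "b k < b (k - 1)" using a_pos[of k] assms by (simp add: a_def)
  from g_bij_betw[of b k, OF this] assms(2)
  show *: "b k \<le> g b k x" "g b k x \<le> b (k - 1)"
    by (auto simp: bij_betw_def)
  show "g b k x \<in> {0..1}" using * b_pos[of k] b_le_1[of "k - 1"] by simp
qed

lemma level_1_le: "level (Suc 0) \<subseteq> level 0"
  unfolding level_Suc level_0 using g_bounds(3) by blast

lemma level_Suc_subset: "level (Suc l) \<subseteq> level l"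
proof (induction l)
  case (Suc l)
  then show ?case unfolding level_Suc[of "Suc l"] level_Suc[of l] by blast
qed (rule level_1_le)

lemma level_antimono: "k \<le> l \<Longrightarrow> level l \<subseteq> level k"
  by (rule lift_Suc_antimono_le[of level, OF level_Suc_subset])

lemma compact_level: "compact (level l)"
proof (induction l)
  case (Suc l)
  have "continuous_on (level l) (g b k)" for k
    unfolding g_eq by (intro continuous_intros)
  then show ?case unfolding level_Suc using Suc
    by (intro compact_UN compact_continuous_image) auto
qed (simp add: level_0)

lemma F_g:
  assumes "k \<in> {1..n}" "x \<in> {0..1}"
  shows "F (g b k x) = c k * (1 - F x) + sum c {k<..n}"
proof -
  have "(b (k - 1) - g b k x) / a k = x" using a_pos[of k] assms by (simp add: g_eq)
  then show ?thesis using F_piece[OF assms(1) g_bounds(1,2)[OF assms]] by simp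
qed

text \<open>Stage 0 is the intermediate value theorem. For the next stage, \<open>y\<close> falls
  into the mass range of some piece, and a preimage of the rescaled value is carried over by
  \<open>g b k\<close>.\<close>

lemma F_level: "{0..1} \<subseteq> F ` level l"
proof (induction l)
  case 0
  show ?case
  proof
    fix y :: real assume "y \<in> {0..1}"
    then have "F 0 \<le> y" "y \<le> F 1"
      using F_eq_0[of 0] F_eq_1[of 1] b_pos[of n] by auto
    then have "\<exists>x\<ge>0. x \<le> 1 \<and> F x = y" by (intro IVT' F_continuous) auto
    then show "y \<in> F ` level 0" unfolding level_0 by auto
  qed
next
  case (Suc l)
  show ?case
  proof
    fix y :: real assume y: "y \<in> {0..1}"
    have "{0<..n} = {1..n}" by auto
    then have "sum c {0<..n} = 1" using sum_c by simp
    \<comment> \<open>The tail masses run from 1 at \<open>k = 0\<close> down to 0 at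
      \<open>k = n\<close>.\<close>
    then obtain k where k: "k \<in> {1..n}" "sum c {k<..n} \<le> y" "y \<le> sum c {k - 1<..n}"
      using ex_bracketing_index[of n "\<lambda>k. sum c {k<..n}" y] y n_pos by auto
    have "{k - 1<..n} = insert k {k<..n}" using k by auto
    then have le: "y \<le> c k + sum c {k<..n}" using k by simp
    have ck: "0 < c k" using c_pos k by simp
    \<comment> \<open>Solves the relation in \<open>F_g\<close> for the value at the
      preimage.\<close>
    define y' where "y' = 1 - (y - sum c {k<..n}) / c k"
    have "y' \<in> {0..1}" using le k ck by (simp add: y'_def)
    then obtain x where x: "x \<in> level l" "F x = y'" using Suc by blast
    have "x \<in> {0..1}" using level_antimono[of 0 l] x by (auto simp: level_0)
    then have "F (g b k x) = y" using F_g[OF k(1)] ck by (simp add: x y'_def)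
    moreover have "g b k x \<in> level (Suc l)" unfolding level_Suc using k x by blast
    ultimately show "y \<in> F ` level (Suc l)" by blast
  qed
qed

text \<open>The closed fibre of \<open>F\<close> over \<open>y\<close> meets every stage, and nested
  nonempty compact sets have a common point.\<close>

lemma F_J: "{0..1} \<subseteq> F ` J b n"
proof
  fix y :: real assume y: "y \<in> {0..1}"
  define S where "S l = level l \<inter> F -` {y}" for l
  have "(\<Inter>l. S l) \<noteq> {}"
  proof (rule compact_nest)
    fix l
    have "closed (F -` {y})" using F_continuous[of UNIV] by (intro closed_vimage) auto
    then show "compact (S l)" unfolding S_def using compact_level by (intro compact_Int_closed)
    have "y \<in> F ` level l" using F_level y by blast
    then show "S l \<noteq> {}" by (auto simp: S_def)
  next
    fix l m :: nat assume "l \<le> m"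
    then show "S m \<subseteq> S l" using level_antimono by (auto simp: S_def)
  qed
  then obtain x where "\<forall>l. x \<in> S l" by blast
  then show "y \<in> F ` J b n" unfolding J_eq S_def by blast
qed

section \<open>Hausdorff measure and dimension of the limit set\<close>

lemma hausdorff_measure_J_ge: "ennreal (1 / C) \<le> hausdorff_measure h (J b n)"
  using F_mono F_Hoelder F_J h C_ge_1 by (intro hausdorff_measure_ge_Hoelder[of F]) auto

lemma compose_word_dist:
  assumes "qs \<in> words l"
  shows "dist (compose_word (g b) qs x) (compose_word (g b) qs y) = prod_list (map a qs) * dist x y"
  using assms
proof (induction l arbitrary: qs)
  case 0
  then show ?case by (simp add: words_0 compose_word_Nil)
next
  case (Suc l)
  then obtain k qs' where qs: "qs = k # qs'" "k \<in> {1..n}" "qs' \<in> words l"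
    by (auto simp: words_Suc)
  have "dist (g b k u) (g b k v) = a k * dist u v" for u v
  proof -
    have "g b k u - g b k v = a k * (v - u)" by (simp add: g_eq right_diff_distrib)
    then show ?thesis using a_pos[of k] qs(2) by (simp add: dist_real_def abs_mult abs_minus_commute)
  qed
  then show ?case using Suc.IH[OF qs(3)] by (simp add: qs(1) compose_word_Cons)
qed

lemma prod_list_words:
  assumes "qs \<in> words l"
  shows "0 < prod_list (map a qs)" "prod_list (map a qs) \<le> a 1 ^ l"
proof -
  have "0 < prod_list (map a qs) \<and> prod_list (map a qs) \<le> a 1 ^ l"
    using assms
  proof (induction l arbitrary: qs)
    case 0
    then show ?case by (simp add: words_0)
  next
    case (Suc l)
    then obtain k qs' where qs: "qs = k # qs'" "k \<in> {1..n}" "qs' \<in> words l"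
      by (auto simp: words_Suc)
    have "0 < a k" "a k \<le> a 1" using a_pos[of k] a_antimono[of 1 k] qs by auto
    with Suc.IH[OF qs(3)] show ?case by (auto simp: qs(1) intro!: mult_mono)
  qed
  then show "0 < prod_list (map a qs)" "prod_list (map a qs) \<le> a 1 ^ l" by auto
qed

text \<open>Cylinder lengths are products over the letters, so each further letter multiplies the
  sum by the Moran sum 1.\<close>

lemma sum_words: "(\<Sum>qs\<in>words l. prod_list (map a qs) powr h) = 1"
proof (induction l)
  case (Suc l)
  have "(\<Sum>qs\<in>words (Suc l). prod_list (map a qs) powr h)
      = (\<Sum>(k, qs)\<in>{1..n} \<times> words l. (a k * prod_list (map a qs)) powr h)"
    unfolding words_Suc by (subst sum.reindex) (auto simp: inj_on_def intro: sum.cong)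
  also have "\<dots> = (\<Sum>(k, qs)\<in>{1..n} \<times> words l. c k * prod_list (map a qs) powr h)"
    using prod_list_words a_pos
    by (intro sum.cong refl) (auto simp: powr_mult c_def less_imp_le)
  also have "\<dots> = (\<Sum>k\<in>{1..n}. \<Sum>qs\<in>words l. c k * prod_list (map a qs) powr h)"
    by (rule sum.cartesian_product[symmetric])
  also have "\<dots> = 1"
    by (simp only: sum_distrib_left[symmetric] Suc mult_1_right sum_c)
  finally show ?case .
qed (simp add: words_0)

lemma hausdorff_measure_J_le: "hausdorff_measure h (J b n) \<le> 1"
proof (rule hausdorff_measure_leI)
  fix \<delta> :: real assume \<delta>: "0 < \<delta>"
  obtain N where N: "a 1 ^ N < \<delta>" using real_arch_pow_inv[OF \<delta> a_1] by blast
  \<comment> \<open>The successor ensures \<open>l \<ge> 1\<close>, as needed for a stage occurring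
    in \<open>J_eq\<close>.\<close>
  define l where "l = Suc N"
  have "a 1 ^ l \<le> a 1 ^ N * 1"
    unfolding l_def power_Suc2 using a_1 a_pos[of 1] by (intro mult_left_mono) auto
  then have l: "a 1 ^ l \<le> \<delta>" "l \<in> {1..}" using N by (auto simp: l_def)
  define V where "V qs = compose_word (g b) qs ` {0..1}" for qs
  have diam: "bounded (V qs)" "diameter (V qs) \<le> prod_list (map a qs)" if "qs \<in> words l" for qs
  proof -
    have dist: "dist x y \<le> prod_list (map a qs)" if "x \<in> V qs" "y \<in> V qs" for x y
    proof -
      obtain u v where "x = compose_word (g b) qs u" "y = compose_word (g b) qs v"
        "u \<in> {0..1}" "v \<in> {0..1}" using \<open>x \<in> V qs\<close> \<open>y \<in> V qs\<close> unfolding V_def by blast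
      moreover have "dist u v \<le> 1" using calculation(3,4) by (auto simp: dist_real_def)
      ultimately show ?thesis
        using compose_word_dist[OF \<open>qs \<in> words l\<close>, of u v] prod_list_words(1)[OF \<open>qs \<in> words l\<close>]
          mult_left_mono[of "dist u v" 1 "prod_list (map a qs)"] by simp
    qed
    then show "bounded (V qs)" unfolding bounded_two_points by blast
    show "diameter (V qs) \<le> prod_list (map a qs)"
      using dist by (intro diameter_le) (auto simp: V_def dist_norm)
  qed
  have "J b n \<subseteq> (\<Union>qs\<in>words l. V qs)"
    using l(2) unfolding J_eq level_def V_def by blast
  then have "hausdorff_pre h \<delta> (J b n) \<le> (\<Sum>qs\<in>words l. diam_pow h (V qs))"
    using finite_words diam(1) order_trans[OF diam(2) order_trans[OF prod_list_words(2) l(1)]] \<delta>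
    by (intro hausdorff_pre_le_sum) auto
  also have "\<dots> \<le> (\<Sum>qs\<in>words l. ennreal (prod_list (map a qs) powr h))"
  proof (rule sum_mono)
    fix qs assume qs: "qs \<in> words l"
    have "diameter (V qs) powr h \<le> prod_list (map a qs) powr h"
      using diam[OF qs] h by (intro powr_mono2 diameter_ge_0) auto
    then show "diam_pow h (V qs) \<le> ennreal (prod_list (map a qs) powr h)"
      using h by (simp add: diam_pow_def ennreal_leI)
  qed
  also have "\<dots> = 1" by (simp add: sum_ennreal sum_words)
  finally show "hausdorff_pre h \<delta> (J b n) \<le> 1" .
qed

text \<open>The \<open>h\<close>-measure lies between \<open>1 / C\<close> and 1, so it is positive
  and finite.\<close>

lemma hausdorff_dim_J: "hausdorff_dim (J b n) = h"
proof (rule hausdorff_dim_eqI)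
  have "0 < ennreal (1 / C)" using C_ge_1 by simp
  then show "0 < hausdorff_measure h (J b n)" using hausdorff_measure_J_ge by (rule less_le_trans)
  show "hausdorff_measure h (J b n) < \<infinity>"
    using hausdorff_measure_J_le by (rule order.strict_trans1) simp
qed (use h in simp)

end

section \<open>Asymptotics of the dimension and the measure\<close>

context convex_ifs
begin

text \<open>Compares \<open>\<Sum>k. a k powr h = 1\<close> with \<open>\<Sum>k. a k = 1 - b n\<close> by means of
  \<open>a powr h = a * exp ((1 - h) * ln (1 / a)) \<ge> a * (1 + (1 - h) * ln (1 / a))\<close>.\<close>

lemma one_minus_h_le: "(1 - h) * (a 1 * ln (1 / a 1)) \<le> b n"
proof -
  define e where "e k = a k * ln (1 / a k)" for k
  have ak: "0 < a k" "a k < 1" if "k \<in> {1..n}" for k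
    using a_pos[of k] a_antimono[of 1 k] a_1 that by auto
  have "a k + (1 - h) * e k \<le> c k" if "k \<in> {1..n}" for k
  proof -
    have "c k = a k powr 1 * a k powr (h - 1)" unfolding powr_add[symmetric] c_def by simp
    also have "\<dots> = a k * exp ((1 - h) * ln (1 / a k))"
      using ak[OF that] by (simp add: powr_def ln_div algebra_simps)
    finally have "c k = a k * exp ((1 - h) * ln (1 / a k))" .
    moreover have "a k * (1 + (1 - h) * ln (1 / a k)) \<le> a k * exp ((1 - h) * ln (1 / a k))"
      using ak[OF that] by (intro mult_left_mono exp_ge_add_one_self) auto
    ultimately show ?thesis by (simp add: e_def algebra_simps)
  qed
  then have "(\<Sum>k\<in>{1..n}. a k + (1 - h) * e k) \<le> 1"
    unfolding sum_c[symmetric] by (intro sum_mono)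
  moreover have "(\<Sum>k\<in>{1..n}. a k + (1 - h) * e k) = 1 - b n + (1 - h) * sum e {1..n}"
  proof -
    have "{1..n} = {0<..n}" by auto
    then show ?thesis using sum_a[of 0 n] by (simp add: sum.distrib sum_distrib_left b_0)
  qed
  \<comment> \<open>All terms \<open>e k\<close> are nonnegative because \<open>a k < 1\<close>;
    keeping only the first leaves a constant independent of \<open>n\<close>.\<close>
  moreover have "(1 - h) * e 1 \<le> (1 - h) * sum e {1..n}"
  proof (intro mult_left_mono member_le_sum)
    show "0 \<le> e k" if "k \<in> {1..n} - {1}" for k
      using ak[of k] that by (auto simp: e_def intro!: mult_nonneg_nonneg)
  qed (use n_pos h in auto)
  ultimately show ?thesis by (simp add: e_def)
qed

text \<open>Inserts \<open>one_minus_h_le\<close> into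
  \<open>\<kappa> = exp ((1 - h) * ln (1 / a n))\<close>.\<close>

lemma \<kappa>_le: "\<kappa> \<le> exp (b n * ln (1 / a n) / (a 1 * ln (1 / a 1)))"
proof -
  have a1: "0 < a 1 * ln (1 / a 1)" using a_pos[of 1] a_1 by simp
  have an: "0 < a n" "a n \<le> 1" using a_pos[of n] a_antimono[of 1 n] a_1 n_pos by auto
  have "\<kappa> = exp ((1 - h) * ln (1 / a n))"
    using an by (simp add: \<kappa>_def powr_def ln_div algebra_simps)
  moreover have "1 - h \<le> b n / (a 1 * ln (1 / a 1))"
    using one_minus_h_le a1 by (simp add: pos_le_divide_eq)
  then have "(1 - h) * ln (1 / a n) \<le> b n / (a 1 * ln (1 / a 1)) * ln (1 / a n)"
    using an by (intro mult_right_mono) auto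
  ultimately show ?thesis by simp
qed

end

section \<open>Existence of the exponent and passage to the limit\<close>

context convex_sequence
begin

text \<open>Intermediate value theorem: the power sum is \<open>n\<close> at exponent 0 and
  \<open>1 - b n < 1\<close> at exponent 1. With \<open>n \<ge> 2\<close> the solution is not
  0.\<close>

lemma ex_moran_exponent:
  assumes "2 \<le> n" shows "\<exists>h. convex_ifs b K n h"
proof -
  define \<phi> where "\<phi> s = (\<Sum>k=1..n. a k powr s)" for s
  have a: "0 < a k" if "k \<in> {1..n}" for k using a_pos that by simp
  have "\<phi> 0 = (\<Sum>k=1..n. 1)"
    unfolding \<phi>_def using a by (intro sum.cong refl) (simp add: less_imp_neq[symmetric])
  then have 0: "\<phi> 0 = real n" by simp
  have "\<phi> 1 = sum a {1..n}"
    unfolding \<phi>_def using a by (intro sum.cong refl) (simp add: less_imp_le)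
  also have "{1..n} = {0<..n}" by auto
  finally have 1: "\<phi> 1 = 1 - b n" using sum_a[of 0 n] b_0 by simp
  have "continuous_on {0..1} \<phi>"
    unfolding \<phi>_def using a by (intro continuous_intros) (auto simp: less_imp_neq[symmetric])
  then have "\<exists>s\<ge>0. s \<le> 1 \<and> \<phi> s = 1"
    using 0 1 assms b_pos[of n] by (intro IVT2') auto
  then obtain s where s: "0 \<le> s" "s \<le> 1" "\<phi> s = 1" by blast
  moreover have "s \<noteq> 0" using 0 s(3) assms by auto
  ultimately have "convex_ifs b K n s" by unfold_locales (auto simp: \<phi>_def)
  then show ?thesis ..
qed

text \<open>Allows the locale to be instantiated with the dimension itself, for each
  \<open>n\<close> separately.\<close>

lemma dim_J:
  assumes "2 \<le> n" shows "convex_ifs b K n (hausdorff_dim (J b n))"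
proof -
  obtain h where "convex_ifs b K n h" using ex_moran_exponent[OF assms] by blast
  then interpret convex_ifs b K n h .
  show ?thesis using convex_ifs_axioms hausdorff_dim_J by simp
qed

theorem dim_J_tendsto:
  assumes "(\<lambda>n. b n * ln (real n)) \<longlonglongrightarrow> 0"
  shows "(\<lambda>n. (1 - hausdorff_dim (J b n)) * ln (real n)) \<longlonglongrightarrow> 0"
proof (rule tendsto_sandwich)
  define e where "e = a 1 * ln (1 / a 1)"
  have e: "0 < e" using a_pos[of 1] a_1 by (simp add: e_def)
  have *: "0 \<le> (1 - hausdorff_dim (J b n)) * ln (real n) \<and>
      (1 - hausdorff_dim (J b n)) * ln (real n) \<le> b n * ln (real n) / e" if n: "2 \<le> n" for n
  proof -
    interpret convex_ifs b K n "hausdorff_dim (J b n)" using n by (rule dim_J)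
    have "1 - hausdorff_dim (J b n) \<le> b n / e"
      using one_minus_h_le e by (simp add: pos_le_divide_eq e_def)
    then have "(1 - hausdorff_dim (J b n)) * ln (real n) \<le> b n / e * ln (real n)"
      using n by (intro mult_right_mono) auto
    then show ?thesis using h n by simp
  qed
  show "\<forall>\<^sub>F n in sequentially. 0 \<le> (1 - hausdorff_dim (J b n)) * ln (real n)"
    using eventually_ge_at_top[of 2] by eventually_elim (use * in blast)
  show "\<forall>\<^sub>F n in sequentially.
      (1 - hausdorff_dim (J b n)) * ln (real n) \<le> b n * ln (real n) / e"
    using eventually_ge_at_top[of 2] by eventually_elim (use * in blast)
  show "(\<lambda>n. b n * ln (real n) / e) \<longlonglongrightarrow> 0"
    using tendsto_divide[OF assms tendsto_const[of e]] e by simp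
qed simp

text \<open>The measure is squeezed between \<open>1 / C n\<close> and 1. The hypothesis sends the
  exponent in \<open>\<kappa>_le\<close> to 0, hence \<kappa> to 1.\<close>

theorem hausdorff_measure_J_tendsto:
  assumes "(\<lambda>n. b n * ln (1 / a n)) \<longlonglongrightarrow> 0"
  shows "(\<lambda>n. hausdorff_measure (hausdorff_dim (J b n)) (J b n)) \<longlonglongrightarrow> 1"
proof (rule tendsto_sandwich)
  define e where "e = a 1 * ln (1 / a 1)"
  define \<kappa> where "\<kappa> n = a n powr (hausdorff_dim (J b n) - 1)" for n
  \<comment> \<open>With \<open>K\<close> fixed, the Hoelder constant depends on \<open>n\<close>
    only through \<open>\<kappa> n\<close>.\<close>
  define C where "C n = \<kappa> n * \<kappa> n * (\<kappa> n + (K - 1) * (\<kappa> n - 1 / \<kappa> n))" for n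
  have *: "1 \<le> \<kappa> n \<and> \<kappa> n \<le> exp (b n * ln (1 / a n) / e) \<and>
      ennreal (1 / C n) \<le> hausdorff_measure (hausdorff_dim (J b n)) (J b n) \<and>
      hausdorff_measure (hausdorff_dim (J b n)) (J b n) \<le> 1" if n: "2 \<le> n" for n
  proof -
    interpret ifs: convex_ifs b K n "hausdorff_dim (J b n)" using n by (rule dim_J)
    show ?thesis
      using ifs.\<kappa>_ge_1 ifs.\<kappa>_le ifs.hausdorff_measure_J_ge ifs.hausdorff_measure_J_le
      unfolding ifs.C_def ifs.A_def ifs.\<kappa>_def C_def \<kappa>_def e_def by blast
  qed
  have ev: "\<forall>\<^sub>F n in sequentially. 2 \<le> n" by (rule eventually_ge_at_top)
  show "\<forall>\<^sub>F n in sequentially.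
      ennreal (1 / C n) \<le> hausdorff_measure (hausdorff_dim (J b n)) (J b n)"
    using ev by eventually_elim (use * in blast)
  show "\<forall>\<^sub>F n in sequentially. hausdorff_measure (hausdorff_dim (J b n)) (J b n) \<le> 1"
    using ev by eventually_elim (use * in blast)
  have "\<kappa> \<longlonglongrightarrow> 1"
  proof (rule tendsto_sandwich)
    show "\<forall>\<^sub>F n in sequentially. 1 \<le> \<kappa> n" using ev by eventually_elim (use * in blast)
    show "\<forall>\<^sub>F n in sequentially. \<kappa> n \<le> exp (b n * ln (1 / a n) / e)"
      using ev by eventually_elim (use * in blast)
    have "0 < e" using a_pos[of 1] a_1 by (simp add: e_def)
    then have "(\<lambda>n. exp (b n * ln (1 / a n) / e)) \<longlonglongrightarrow> exp (0 / e)"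
      by (intro tendsto_intros assms) simp
    then show "(\<lambda>n. exp (b n * ln (1 / a n) / e)) \<longlonglongrightarrow> 1" by simp
  qed simp
  then have "(\<lambda>n. 1 / C n) \<longlonglongrightarrow> 1 / (1 * 1 * (1 + (K - 1) * (1 - 1 / 1)))"
    unfolding C_def by (intro tendsto_intros) auto
  then have "(\<lambda>n. ennreal (1 / C n)) \<longlonglongrightarrow> ennreal 1"
    by (intro tendsto_ennrealI) simp
  then show "(\<lambda>n. ennreal (1 / C n)) \<longlonglongrightarrow> 1" by simp
qed simp

lemma SUP_ratio: "(SUP k\<in>{1..}. ereal ((b k - b (k + 1)) / b (k + 1))) < \<infinity>"
proof -
  have "(b k - b (k + 1)) / b (k + 1) \<le> K - 1" for k
    unfolding pos_divide_le_eq[OF b_pos] using b_ratio[of k] by (simp add: left_diff_distrib)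
  then have "(SUP k\<in>{1..}. ereal ((b k - b (k + 1)) / b (k + 1))) \<le> ereal (K - 1)"
    by (intro SUP_least) (simp only: ereal_less_eq)
  also have "\<dots> < \<infinity>" by simp
  finally show ?thesis .
qed

end

section \<open>The geometric and the power sequences\<close>

lemma convex_sequence_if_log_convex:
  fixes b :: "nat \<Rightarrow> real"
  assumes b: "b 0 = 1" "\<And>k. 0 < b k" "\<And>k. b (Suc k) < b k"
    and log_convex: "\<And>k. (b (Suc k))\<^sup>2 \<le> b k * b (Suc (Suc k))"
  shows "convex_sequence b (1 / b 1)"
proof
  fix k
  \<comment> \<open>Log-convexity gives convexity by the inequality of arithmetic and geometric
    means.\<close>
  have "(2 * b (Suc k))\<^sup>2 \<le> 4 * (b k * b (Suc (Suc k)))"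
    using log_convex[of k] by (simp add: power_mult_distrib)
  also have "\<dots> \<le> (b k + b (Suc (Suc k)))\<^sup>2"
    using sum_squares_bound[of "b k" "b (Suc (Suc k))"] by (simp add: power2_sum)
  finally have "2 * b (Suc k) \<le> b k + b (Suc (Suc k))"
    by (rule power2_le_imp_le) (use b(2)[of k] b(2)[of "Suc (Suc k)"] in simp)
  then show "b (Suc k) - b (Suc (Suc k)) \<le> b k - b (Suc k)" by simp
  \<comment> \<open>By log-convexity the ratios \<open>b (Suc k) / b k\<close> do not decrease, so
    the first one, \<open>b 1\<close>, bounds them below.\<close>
  have "b 1 * b k \<le> b (Suc k)" for k
  proof (induction k)
    case (Suc k)
    have "(b 1 * b (Suc k)) * b k = (b 1 * b k) * b (Suc k)" by simp
    also have "\<dots> \<le> b (Suc k) * b (Suc k)" using Suc b(2)[of "Suc k"] by (intro mult_right_mono) auto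
    also have "\<dots> \<le> b (Suc (Suc k)) * b k"
      using log_convex[of k] by (simp add: power2_eq_square mult.commute)
    finally show ?case using b(2)[of k] by simp
  qed (simp add: b)
  then show "b k \<le> 1 / b 1 * b (Suc k)" using b(2)[of 1] by (simp add: field_simps)
qed (use b in auto)

lemma geometric_sequence:
  assumes q: "0 < q" "q < 1"
  defines "b \<equiv> \<lambda>k. q ^ k"
  shows "convex_sequence b (1 / b 1)" "(\<lambda>n. b n * ln (real n)) \<longlonglongrightarrow> 0"
    "(\<lambda>n. b n * ln (1 / (b (n - 1) - b n))) \<longlonglongrightarrow> 0"
proof -
  show "convex_sequence b (1 / b 1)"
    using q unfolding b_def
    by (intro convex_sequence_if_log_convex) (auto simp: power2_eq_square power_Suc_less)
  show "(\<lambda>n. b n * ln (real n)) \<longlonglongrightarrow> 0"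
    unfolding b_def using q by real_asymp
  \<comment> \<open>The gap is a fixed multiple of \<open>q ^ n\<close>, so its logarithm is affine
    in \<open>n\<close> and is beaten by the factor \<open>q ^ n\<close>.\<close>
  have eq: "b n * ln (1 / (b (n - 1) - b n)) = - (real n * q ^ n * ln q) - q ^ n * ln (1 / q - 1)"
    if "1 \<le> n" for n
  proof -
    have "q ^ n = q * q ^ (n - 1)" using that by (cases n) auto
    then have "q ^ (n - 1) - q ^ n = q ^ n * (1 / q - 1)" using q by (simp add: field_simps)
    moreover have "0 < q ^ n" "0 < 1 / q - 1" using q by auto
    ultimately have "ln (1 / (q ^ (n - 1) - q ^ n)) = - (real n * ln q + ln (1 / q - 1))"
      using q by (simp only: ln_div ln_mult ln_realpow) (simp add: ln_mult ln_realpow ln_inverse)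
    then have "b n * ln (1 / (b (n - 1) - b n)) = q ^ n * - (real n * ln q + ln (1 / q - 1))"
      by (simp only: b_def)
    then show ?thesis by (simp add: right_diff_distrib mult_ac)
  qed
  have "(\<lambda>n. - (real n * q ^ n * ln q) - q ^ n * ln (1 / q - 1)) \<longlonglongrightarrow> - (0 * ln q) - 0 * ln (1 / q - 1)"
    using q by (intro tendsto_intros powser_times_n_limit_0 LIMSEQ_realpow_zero) auto
  then have "(\<lambda>n. - (real n * q ^ n * ln q) - q ^ n * ln (1 / q - 1)) \<longlonglongrightarrow> 0" by simp
  then show "(\<lambda>n. b n * ln (1 / (b (n - 1) - b n))) \<longlonglongrightarrow> 0"
    by (rule Lim_transform_eventually) (rule eventually_sequentiallyI[of 1], rule eq[symmetric])
qed

lemma power_sequence: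
  assumes \<alpha>: "0 < \<alpha>"
  defines "b \<equiv> \<lambda>k. 1 / (real k + 1) powr \<alpha>"
  shows "convex_sequence b (1 / b 1)" "(\<lambda>n. b n * ln (real n)) \<longlonglongrightarrow> 0"
    "(\<lambda>n. b n * ln (1 / (b (n - 1) - b n))) \<longlonglongrightarrow> 0"
proof -
  show "convex_sequence b (1 / b 1)"
  proof (rule convex_sequence_if_log_convex)
    fix k
    show "0 < b k" by (simp add: b_def)
    show "b (Suc k) < b k" using \<alpha> by (simp add: b_def frac_less2 powr_less_mono2)
    \<comment> \<open>Log-convexity amounts to \<open>(k + 1) * (k + 3) \<le> (k + 2) ^ 2\<close>,
      raised to the power \<alpha>.\<close>
    have "(real k + 1) powr \<alpha> * (real k + 3) powr \<alpha> = ((real k + 1) * (real k + 3)) powr \<alpha>"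
      by (simp add: powr_mult)
    also have "\<dots> \<le> ((real k + 2) * (real k + 2)) powr \<alpha>"
      using \<alpha> by (intro powr_mono2) (auto simp: algebra_simps)
    also have "\<dots> = (real k + 2) powr \<alpha> * (real k + 2) powr \<alpha>" by (simp add: powr_mult)
    finally show "(b (Suc k))\<^sup>2 \<le> b k * b (Suc (Suc k))"
      by (simp add: b_def power2_eq_square frac_le add.commute)
  qed (simp add: b_def)
  show "(\<lambda>n. b n * ln (real n)) \<longlonglongrightarrow> 0"
    unfolding b_def using \<alpha> by real_asymp
  \<comment> \<open>Here \<open>b (n - 1)\<close> is written as
    \<open>1 / real n powr \<alpha>\<close>; because of truncated subtraction this is correct only
    from \<open>n = 1\<close> on.\<close>
  have "(\<lambda>n. 1 / (real n + 1) powr \<alpha> * ln (1 / (1 / real n powr \<alpha> - 1 / (real n + 1) powr \<alpha>)))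
      \<longlonglongrightarrow> 0"
    using \<alpha> by real_asymp
  then show "(\<lambda>n. b n * ln (1 / (b (n - 1) - b n))) \<longlonglongrightarrow> 0"
    by (rule Lim_transform_eventually)
      (rule eventually_sequentiallyI[of 1], simp add: b_def of_nat_diff)
qed

theorem lemma5p2:
  fixes b :: "nat \<Rightarrow> real"
  assumes "(\<exists>q. 0 < q \<and> q < 1 \<and> (\<forall>k. b k = q ^ k)) \<or>
           (\<exists>\<alpha>>0. \<forall>k. b k = 1 / (real k + 1) powr \<alpha>)"
  shows "(\<lambda>n. (1 - hausdorff_dim (J b n)) * ln (real n)) \<longlonglongrightarrow> 0 \<and>
         (SUP k\<in>{1..}. ereal ((b k - b (k + 1)) / b (k + 1))) < \<infinity> \<and>
         (\<lambda>n. hausdorff_measure (hausdorff_dim (J b n)) (J b n)) \<longlonglongrightarrow> 1"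
proof -
  \<comment> \<open>Both families enter the rest of the argument only through these three
    facts.\<close>
  have b: "convex_sequence b (1 / b 1) \<and> (\<lambda>n. b n * ln (real n)) \<longlonglongrightarrow> 0 \<and>
      (\<lambda>n. b n * ln (1 / (b (n - 1) - b n))) \<longlonglongrightarrow> 0"
    using assms
  proof
    assume "\<exists>q. 0 < q \<and> q < 1 \<and> (\<forall>k. b k = q ^ k)"
    then obtain q where "0 < q" "q < 1" "b = (\<lambda>k. q ^ k)" by auto
    then show ?thesis using geometric_sequence[of q] by simp
  next
    assume "\<exists>\<alpha>>0. \<forall>k. b k = 1 / (real k + 1) powr \<alpha>"
    then obtain \<alpha> where "0 < \<alpha>" "b = (\<lambda>k. 1 / (real k + 1) powr \<alpha>)" by auto
    then show ?thesis using power_sequence[of \<alpha>] by simp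
  qed
  then interpret convex_sequence b "1 / b 1" by blast
  show ?thesis
    using b dim_J_tendsto hausdorff_measure_J_tendsto SUP_ratio by (simp add: a_def)
qed

end
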